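(* (i) Every trajectory of a re-entry system of dimension $n$ is ultimately periodic, with preperiod and period jointly bounded by $2^{n}$ (i.e. their sum is at most $2^n$). (ii) For every formula $\varphi$ of monadic second-order logic over $(\mathbb{N},\mathrm{succ})$ with free set variables $X_1,\dots,X_n$, it is decidable whether the trajectory of a given re-entry system (of dimension $n$) from a given initial state satisfies $\varphi$ when $X_i$ is read as the $i$-th coordinate of the trajectory (i.e. as the set of times at which the $i$-th coordinate equals $1$); in particular, equality of the trajectories of two given systems, from given or from all initial states, is decidable.
   Context: Primary-algebra expressions in variables $x_1,\dots,x_n$ are built from the variables and the empty expression by juxtaposition $(f,g)\mapsto fg$ and enclosure $f\mapsto\langle f\rangle$. Under the two-element evaluation in $\{0,1\}$, juxtaposition is join (disjunction; the empty expression evaluates to its neutral element $0$) and enclosure is complement (negation). A re-entry system of dimension $n$ is an $n$-tuple $E_1,\dots,E_n$ of primary-algebra expressions in $x_1,\dots,x_n$; it defines the synchronous update map $F\colon\{0,1\}^n\to\{0,1\}^n$ whose $i$-th coordinate is the two-element evaluation of $E_i$. A trajectory is a sequence $(F^{k}(a))_{k\in\mathbb{N}}$ for an initial state $a\in\{0,1\}^n$. *)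

theory Defs
  imports Main "HOL-Library.Nat_Bijection"
begin

section \<open>Re-entry systems\<close>

text \<open>Variables are numbered from 0: \<open>Var i\<close> is $x_{i+1}$, and likewise for coordinates of
  states and for the set variables of formulas below.\<close>

datatype pexpr = Void | Var nat | Juxt pexpr pexpr | Encl pexpr

primrec pvars :: "pexpr \<Rightarrow> nat set" where
  "pvars Void = {}"
| "pvars (Var i) = {i}"
| "pvars (Juxt f g) = pvars f \<union> pvars g"
| "pvars (Encl f) = pvars f"

primrec peval :: "(nat \<Rightarrow> bool) \<Rightarrow> pexpr \<Rightarrow> bool" where
  "peval v Void \<longleftrightarrow> False"
| "peval v (Var i) \<longleftrightarrow> v i"
| "peval v (Juxt f g) \<longleftrightarrow> peval v f \<or> peval v g"
| "peval v (Encl f) \<longleftrightarrow> \<not> peval v f"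

definition reentry_system :: "nat \<Rightarrow> pexpr list \<Rightarrow> bool" where
  "reentry_system n Es \<longleftrightarrow> length Es = n \<and> (\<forall>E\<in>set Es. pvars E \<subseteq> {..<n})"

text \<open>The two-element algebra is \<^typ>\<open>bool\<close>; elements of $\{0,1\}^n$ are lists of length $n$.\<close>

definition update :: "pexpr list \<Rightarrow> bool list \<Rightarrow> bool list" where
  "update Es a = map (peval (\<lambda>i. a ! i)) Es"

definition trajectory :: "pexpr list \<Rightarrow> bool list \<Rightarrow> nat \<Rightarrow> bool list" where
  "trajectory Es a k = (update Es ^^ k) a"

definition ultimately_periodic :: "(nat \<Rightarrow> 'a) \<Rightarrow> nat \<Rightarrow> nat \<Rightarrow> bool" where
  "ultimately_periodic s preperiod period \<longleftrightarrow>
     period > 0 \<and> (\<forall>k\<ge>preperiod. s (k + period) = s k)"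

section \<open>Monadic second-order logic over the natural numbers with successor\<close>

text \<open>First-order and set variables are two separate sorts, each named by natural numbers.\<close>

datatype mso =
    Eq nat nat
  | Succ nat nat
  | Mem nat nat
  | Neg mso
  | Conj mso mso
  | Ex1 nat mso
  | Ex2 nat mso

primrec sat :: "(nat \<Rightarrow> nat) \<Rightarrow> (nat \<Rightarrow> nat set) \<Rightarrow> mso \<Rightarrow> bool" where
  "sat e S (Eq x y) \<longleftrightarrow> e x = e y"
| "sat e S (Succ x y) \<longleftrightarrow> e y = Suc (e x)"
| "sat e S (Mem x X) \<longleftrightarrow> e x \<in> S X"
| "sat e S (Neg \<phi>) \<longleftrightarrow> \<not> sat e S \<phi>"
| "sat e S (Conj \<phi> \<psi>) \<longleftrightarrow> sat e S \<phi> \<and> sat e S \<psi>"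
| "sat e S (Ex1 x \<phi>) \<longleftrightarrow> (\<exists>t. sat (e(x := t)) S \<phi>)"
| "sat e S (Ex2 X \<phi>) \<longleftrightarrow> (\<exists>A. sat e (S(X := A)) \<phi>)"

primrec free1 :: "mso \<Rightarrow> nat set" where
  "free1 (Eq x y) = {x, y}"
| "free1 (Succ x y) = {x, y}"
| "free1 (Mem x X) = {x}"
| "free1 (Neg \<phi>) = free1 \<phi>"
| "free1 (Conj \<phi> \<psi>) = free1 \<phi> \<union> free1 \<psi>"
| "free1 (Ex1 x \<phi>) = free1 \<phi> - {x}"
| "free1 (Ex2 X \<phi>) = free1 \<phi>"

primrec free2 :: "mso \<Rightarrow> nat set" where
  "free2 (Eq x y) = {}"
| "free2 (Succ x y) = {}"
| "free2 (Mem x X) = {X}"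
| "free2 (Neg \<phi>) = free2 \<phi>"
| "free2 (Conj \<phi> \<psi>) = free2 \<phi> \<union> free2 \<psi>"
| "free2 (Ex1 x \<phi>) = free2 \<phi>"
| "free2 (Ex2 X \<phi>) = free2 \<phi> - {X}"

definition mso_formula :: "nat \<Rightarrow> mso \<Rightarrow> bool" where
  "mso_formula n \<phi> \<longleftrightarrow> free1 \<phi> = {} \<and> free2 \<phi> \<subseteq> {..<n}"

text \<open>Only meaningful for \<open>mso_formula n \<phi>\<close> with \<open>n\<close> the dimension of the system: then neither
  the dummy first-order assignment nor the sets assigned to \<open>i \<ge> n\<close> matter.\<close>

definition trajectory_sat :: "pexpr list \<Rightarrow> bool list \<Rightarrow> mso \<Rightarrow> bool" where
  "trajectory_sat Es a \<phi> \<longleftrightarrow> sat (\<lambda>_. 0) (\<lambda>i. {t. trajectory Es a t ! i}) \<phi>"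

section \<open>Decidability\<close>

text \<open>\<open>recursive n f\<close>: the restriction of \<open>f\<close> to argument lists of length \<open>n\<close> is a total recursive
  function of arity \<open>n\<close> (Kleene's general recursive functions, where minimisation is applied to
  regular functions only).  Values of \<open>f\<close> on lists of any other length play no role: every
  clause calls its component functions on lists of the correct length.\<close>

inductive recursive :: "nat \<Rightarrow> (nat list \<Rightarrow> nat) \<Rightarrow> bool" where
  zero: "recursive n (\<lambda>xs. 0)"
| succ: "recursive 1 (\<lambda>xs. Suc (xs ! 0))"
| proj: "i < n \<Longrightarrow> recursive n (\<lambda>xs. xs ! i)"
| comp: "recursive (length gs) f \<Longrightarrow> (\<And>g. g \<in> set gs \<Longrightarrow> recursive n g) \<Longrightarrow>
    recursive n (\<lambda>xs. f (map (\<lambda>g. g xs) gs))"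
| prim_rec: "recursive n f \<Longrightarrow> recursive (n + 2) g \<Longrightarrow>
    recursive (n + 1) (\<lambda>xs. rec_nat (f (tl xs)) (\<lambda>k r. g (k # r # tl xs)) (hd xs))"
| minim: "recursive (n + 1) f \<Longrightarrow> (\<And>xs. length xs = n \<Longrightarrow> \<exists>y. f (y # xs) = 0) \<Longrightarrow>
    recursive n (\<lambda>xs. LEAST y. f (y # xs) = 0)"

definition decidable :: "nat set \<Rightarrow> bool" where
  "decidable A \<longleftrightarrow> (\<exists>f. recursive 1 f \<and> (\<forall>x. f [x] = of_bool (x \<in> A)))"

primrec code_pexpr :: "pexpr \<Rightarrow> nat" where
  "code_pexpr Void = prod_encode (0, 0)"
| "code_pexpr (Var i) = prod_encode (1, i)"
| "code_pexpr (Juxt f g) = prod_encode (2, prod_encode (code_pexpr f, code_pexpr g))"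
| "code_pexpr (Encl f) = prod_encode (3, code_pexpr f)"

primrec code_mso :: "mso \<Rightarrow> nat" where
  "code_mso (Eq x y) = prod_encode (0, prod_encode (x, y))"
| "code_mso (Succ x y) = prod_encode (1, prod_encode (x, y))"
| "code_mso (Mem x X) = prod_encode (2, prod_encode (x, X))"
| "code_mso (Neg \<phi>) = prod_encode (3, code_mso \<phi>)"
| "code_mso (Conj \<phi> \<psi>) = prod_encode (4, prod_encode (code_mso \<phi>, code_mso \<psi>))"
| "code_mso (Ex1 x \<phi>) = prod_encode (5, prod_encode (x, code_mso \<phi>))"
| "code_mso (Ex2 X \<phi>) = prod_encode (6, prod_encode (X, code_mso \<phi>))"

definition code_system :: "pexpr list \<Rightarrow> nat" where
  "code_system Es = list_encode (map code_pexpr Es)"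

definition code_state :: "bool list \<Rightarrow> nat" where
  "code_state a = list_encode (map of_bool a)"

lemma code_pexpr_inject: "code_pexpr E = code_pexpr E' \<longleftrightarrow> E = E'"
proof (induction E arbitrary: E')
  case Void show ?case by (cases E') auto
next
  case (Var i) show ?case by (cases E') auto
next
  case (Juxt f g) then show ?case by (cases E') auto
next
  case (Encl f) then show ?case by (cases E') auto
qed

lemma code_mso_inject: "code_mso \<phi> = code_mso \<psi> \<longleftrightarrow> \<phi> = \<psi>"
proof (induction \<phi> arbitrary: \<psi>)
  case (Eq x y) show ?case by (cases \<psi>) auto
next
  case (Succ x y) show ?case by (cases \<psi>) auto
next
  case (Mem x X) show ?case by (cases \<psi>) auto
next
  case (Neg \<phi>) then show ?case by (cases \<psi>) auto
next
  case (Conj \<phi> \<phi>') then show ?case by (cases \<psi>) auto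
next
  case (Ex1 x \<phi>) then show ?case by (cases \<psi>) auto
next
  case (Ex2 X \<phi>) then show ?case by (cases \<psi>) auto
qed

lemma code_system_inject: "code_system Es = code_system Es' \<longleftrightarrow> Es = Es'"
proof -
  have "inj code_pexpr"
    by (simp add: inj_def code_pexpr_inject)
  then show ?thesis
    by (simp add: code_system_def list_encode_eq inj_map_eq_map)
qed

lemma code_state_inject: "code_state a = code_state b \<longleftrightarrow> a = b"
proof -
  have "inj (of_bool :: bool \<Rightarrow> nat)"
    by (simp add: inj_def)
  then show ?thesis
    by (simp add: code_state_def list_encode_eq inj_map_eq_map)
qed

end

theory Submission imports Defs "HOL-Library.Ramsey" begin

text \<open>A trajectory is an orbit in a set of $2^n$ states, hence ultimately periodic.  For the decidability
  of monadic second-order logic we use Shelah's composition method: every formula gets a finite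
  semigroup, computed by recursion on the formula, and a morphism from finite words to it, such that
  the truth of the formula in $u v_1 v_2 \ldots$ depends only on the type $s$ of $u$ and the
  common type $e$ of the $v_i$.  Conjunction corresponds to the product of semigroups and
  quantification to the semigroup of subsets, where Ramsey's theorem shows that it suffices
  to try finitely many powers of $e$.  A trajectory decomposes as $u v v \ldots$ with computable $u$, $v$.
  Two trajectories are equal iff they agree up to time $2^n$, and two systems have the same trajectories
  from all states iff their update maps agree.\<close>

section \<open>Computable functions\<close>

text \<open>\<open>decidable\<close> speaks about recursive functions on codes, so it is not enough
  that every formula has a finite semigroup: products, letter types and accepted pairs must each be
  computed by one function of the code of the formula. That recursion is nested: at a quantifier,
  the product of two sets of types asks for the product of the body at many other arguments.
  \<open>computable_nested_recursion\<close> reduces such recursions to primitive recursion once,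
  and every interpreter of codes below is an instance of it. For the same reason types are plain
  numbers: pairs of types are Cantor codes, sets of types are binary numerals, and the products are
  associative on all of \<open>nat\<close>, so that no carrier set has to be computed.
  \<open>type_bound\<close> only bounds the types of actual words, which makes the searches finite.
  The cost of the logic sits in the quantifiers alone, since acceptance is a property of the pair of
  types and negation just complements it. For a trajectory no minimal preperiod is sought: time
  \<open>2 ^ n\<close> always lies in the periodic part, and any later return to its state closes a
  usable loop.\<close>

definition recursive_on :: "nat \<Rightarrow> (nat list \<Rightarrow> nat) \<Rightarrow> bool" where
  "recursive_on n f \<longleftrightarrow> (\<exists>g. recursive n g \<and> (\<forall>xs. length xs = n \<longrightarrow> g xs = f xs))"

lemma recursive_on_proj: "i < n \<Longrightarrow> recursive_on n (\<lambda>xs. xs ! i)"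
  unfolding recursive_on_def using recursive.proj by blast

text \<open>The composite only sees its components on lists of the right length, so witnesses that
  agree with them there are good enough. Working up to this agreement lets functions be rewritten
  freely, whereas the clauses of \<open>recursive\<close> fix one particular function on all
  lists.\<close>

lemma recursive_on_comp:
  assumes "recursive_on (length gs) f" "\<And>g. g \<in> set gs \<Longrightarrow> recursive_on n g"
  shows "recursive_on n (\<lambda>xs. f (map (\<lambda>g. g xs) gs))"
proof -
  obtain f' where f': "recursive (length gs) f'" "\<And>xs. length xs = length gs \<Longrightarrow> f' xs = f xs"
    using assms(1) unfolding recursive_on_def by blast
  obtain G where G: "recursive n (G g)" "length xs = n \<Longrightarrow> G g xs = g xs"
    if "g \<in> set gs" for g xs
    using assms(2) unfolding recursive_on_def by metis
  have "recursive n (\<lambda>xs. f' (map (\<lambda>g. g xs) (map G gs)))"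
    by (rule recursive.comp) (use f'(1) G(1) in auto)
  moreover have "f' (map (\<lambda>g. g xs) (map G gs)) = f (map (\<lambda>g. g xs) gs)" if "length xs = n" for xs
  proof -
    have "map (\<lambda>g. g xs) (map G gs) = map (\<lambda>g. g xs) gs"
      using G(2) that by auto
    moreover have "f' (map (\<lambda>g. g xs) (map G gs)) = f (map (\<lambda>g. g xs) (map G gs))"
      by (rule f'(2)) simp
    ultimately show ?thesis by (simp only:)
  qed
  ultimately show ?thesis unfolding recursive_on_def by blast
qed

lemma recursive_on_comp1:
  assumes "recursive_on 1 (\<lambda>xs. f (xs ! 0))" "recursive_on n g"
  shows "recursive_on n (\<lambda>xs. f (g xs))"
  using recursive_on_comp[of "[g]" "\<lambda>xs. f (xs ! 0)" n] assms by simp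

lemma recursive_on_comp2:
  assumes "recursive_on 2 (\<lambda>xs. f (xs ! 0) (xs ! 1))" "recursive_on n g" "recursive_on n h"
  shows "recursive_on n (\<lambda>xs. f (g xs) (h xs))"
  using recursive_on_comp[of "[g, h]" "\<lambda>xs. f (xs ! 0) (xs ! 1)" n] assms
  by (auto simp: numeral_2_eq_2)

lemma recursive_on_Suc: "recursive_on n g \<Longrightarrow> recursive_on n (\<lambda>xs. Suc (g xs))"
  by (rule recursive_on_comp1, unfold recursive_on_def) (use recursive.succ in blast)

lemma recursive_on_const: "recursive_on n (\<lambda>xs. c)"
proof (induction c)
  case 0 then show ?case unfolding recursive_on_def using recursive.zero by blast
next
  case (Suc c) then show ?case by (rule recursive_on_Suc)
qed

lemma recursive_on_rec:
  assumes "recursive_on n f" "recursive_on (n + 2) g"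
  shows "recursive_on (n + 1) (\<lambda>xs. rec_nat (f (tl xs)) (\<lambda>k r. g (k # r # tl xs)) (hd xs))"
proof -
  obtain f' g' where f': "recursive n f'" "\<And>xs. length xs = n \<Longrightarrow> f' xs = f xs"
    and g': "recursive (n + 2) g'" "\<And>xs. length xs = n + 2 \<Longrightarrow> g' xs = g xs"
    using assms unfolding recursive_on_def by blast
  have "recursive (n + 1) (\<lambda>xs. rec_nat (f' (tl xs)) (\<lambda>k r. g' (k # r # tl xs)) (hd xs))"
    by (rule recursive.prim_rec[OF f'(1) g'(1)])
  moreover have "rec_nat (f' (tl xs)) (\<lambda>k r. g' (k # r # tl xs)) (hd xs)
      = rec_nat (f (tl xs)) (\<lambda>k r. g (k # r # tl xs)) (hd xs)" if "length xs = n + 1" for xs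
    using that by (simp add: f'(2) g'(2))
  ultimately show ?thesis unfolding recursive_on_def by blast
qed

lemma recursive_on_rec1:
  assumes "recursive_on 2 (\<lambda>xs. s (xs ! 0) (xs ! 1))" "recursive_on n m"
  shows "recursive_on n (\<lambda>xs. rec_nat b s (m xs))"
proof (rule recursive_on_comp1[OF _ assms(2)])
  show "recursive_on 1 (\<lambda>xs. rec_nat b s (xs ! 0))"
    using recursive_on_rec[OF recursive_on_const[of 0 b], of "\<lambda>xs. s (xs ! 0) (xs ! 1)"] assms(1)
    unfolding recursive_on_def by (auto simp: hd_conv_nth numeral_2_eq_2 length_Suc_conv)
qed

lemma recursive_on_rec2:
  assumes "recursive_on 1 (\<lambda>xs. b (xs ! 0))"
    and "recursive_on 3 (\<lambda>xs. s (xs ! 0) (xs ! 1) (xs ! 2))"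
    and "recursive_on n m" "recursive_on n p"
  shows "recursive_on n (\<lambda>xs. rec_nat (b (p xs)) (\<lambda>k r. s k r (p xs)) (m xs))"
proof (rule recursive_on_comp2[OF _ assms(3,4)])
  show "recursive_on 2 (\<lambda>xs. rec_nat (b (xs ! 1)) (\<lambda>k r. s k r (xs ! 1)) (xs ! 0))"
    using recursive_on_rec[of 1 "\<lambda>xs. b (xs ! 0)" "\<lambda>xs. s (xs ! 0) (xs ! 1) (xs ! 2)"] assms(1,2)
    unfolding recursive_on_def
    by (auto simp: hd_conv_nth numeral_2_eq_2 numeral_3_eq_3 length_Suc_conv)
qed

section \<open>Arithmetic by primitive recursion\<close>

lemma recursive_on_add:
  assumes "recursive_on n f" "recursive_on n g"
  shows "recursive_on n (\<lambda>xs. f xs + g xs)"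
proof -
  have "rec_nat y (\<lambda>k r. Suc r) x = x + y" for x y :: nat
    by (induction x) auto
  with recursive_on_rec2[of "\<lambda>y. y" "\<lambda>k r y. Suc r", OF _ _ assms] show ?thesis
    by (simp add: recursive_on_proj recursive_on_Suc)
qed

lemma recursive_on_diff:
  assumes "recursive_on n f" "recursive_on n g"
  shows "recursive_on n (\<lambda>xs. f xs - g xs)"
proof -
  have "rec_nat 0 (\<lambda>k r. k) x = x - 1" for x :: nat
    by (induction x) auto
  then have pred: "recursive_on m (\<lambda>xs. h xs - 1)" if "recursive_on m h" for m h
    using recursive_on_rec1[of "\<lambda>k r. k", OF _ that, where b = 0] by (simp add: recursive_on_proj)
  have "rec_nat y (\<lambda>k r. r - 1) x = y - x" for x y :: nat
    by (induction x) auto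
  with recursive_on_rec2[of "\<lambda>y. y" "\<lambda>k r y. r - 1", OF _ _ assms(2,1)] show ?thesis
    using pred[of 3 "\<lambda>xs. xs ! 1"] by (simp add: recursive_on_proj)
qed

lemma recursive_on_mult:
  assumes "recursive_on n f" "recursive_on n g"
  shows "recursive_on n (\<lambda>xs. f xs * g xs)"
proof -
  have "rec_nat 0 (\<lambda>k r. r + y) x = x * y" for x y :: nat
    by (induction x) auto
  with recursive_on_rec2[of "\<lambda>y. 0" "\<lambda>k r y. r + y", OF _ _ assms] show ?thesis
    by (simp add: recursive_on_proj recursive_on_const recursive_on_add)
qed

section \<open>The Cantor pairing function and its projections\<close>

definition pfst :: "nat \<Rightarrow> nat" where "pfst x = fst (prod_decode x)"
definition psnd :: "nat \<Rightarrow> nat" where "psnd x = snd (prod_decode x)"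

lemma pfst_prod_encode [simp]: "pfst (prod_encode (a, b)) = a"
  and psnd_prod_encode [simp]: "psnd (prod_encode (a, b)) = b"
  and prod_encode_pfst_psnd [simp]: "prod_encode (pfst x, psnd x) = x"
  by (simp_all add: pfst_def psnd_def)

lemma pfst_le: "pfst x \<le> x" and psnd_le: "psnd x \<le> x"
  by (metis le_prod_encode_1 prod_encode_pfst_psnd, metis le_prod_encode_2 prod_encode_pfst_psnd)

text \<open>Strictness matters for recursion on codes: a positive tag makes the coded remainder
  smaller than the code.\<close>

lemma psnd_less: "pfst x > 0 \<Longrightarrow> psnd x < x"
proof -
  assume "pfst x > 0"
  then obtain a where a: "pfst x = Suc a" by (cases "pfst x") auto
  have "psnd x < prod_encode (Suc a, psnd x)"
    by (simp add: prod_encode_def)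
  then show ?thesis using a by (metis prod_encode_pfst_psnd)
qed

lemma prod_encode_mono: "a \<le> a' \<Longrightarrow> b \<le> b' \<Longrightarrow> prod_encode (a, b) \<le> prod_encode (a', b')"
proof -
  have "triangle m \<le> triangle n" if "m \<le> n" for m n
    using that by (induction rule: dec_induct) auto
  then show "a \<le> a' \<Longrightarrow> b \<le> b' \<Longrightarrow> ?thesis"
    unfolding prod_encode_def by (simp add: add_mono)
qed

lemma prod_encode_less: "a < a' \<Longrightarrow> b < b' \<Longrightarrow> prod_encode (a, b) < prod_encode (a', b')"
  using prod_encode_mono[of a a' b b'] by (auto simp: order_less_le)

lemma recursive_on_triangle:
  assumes "recursive_on n f"
  shows "recursive_on n (\<lambda>xs. triangle (f xs))"
proof -
  have "rec_nat 0 (\<lambda>k r. r + Suc k) x = triangle x" for x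
    by (induction x) auto
  with recursive_on_rec1[of "\<lambda>k r. r + Suc k", OF _ assms, where b = 0] show ?thesis
    by (simp add: recursive_on_proj recursive_on_Suc recursive_on_add del: add_Suc_right)
qed

lemma recursive_on_prod_encode:
  assumes "recursive_on n f" "recursive_on n g"
  shows "recursive_on n (\<lambda>xs. prod_encode (f xs, g xs))"
  unfolding prod_encode_def using assms by (simp add: recursive_on_add recursive_on_triangle)

text \<open>The index of the diagonal containing \<open>x\<close>: \<open>x = triangle (pfst x + psnd x) + pfst x\<close>.\<close>

lemma pfst_psnd_eq_rec:
  "rec_nat 0 (\<lambda>k r. r + (1 - (triangle (Suc r) - Suc k))) x = pfst x + psnd x"
proof (induction x)
  case 0
  have "prod_encode (0, 0) = 0" by (simp add: prod_encode_def)
  then show ?case by (metis add_0 pfst_prod_encode psnd_prod_encode old.nat.rec(1))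
next
  case (Suc x)
  define w where "w = pfst x + psnd x"
  obtain a b where x: "x = prod_encode (a, b)"
    by (metis prod_encode_pfst_psnd)
  have w: "w = a + b" by (simp add: w_def x)
  have "w + (1 - (triangle (Suc w) - Suc x)) = pfst (Suc x) + psnd (Suc x)"
  proof (cases b)
    \<comment> \<open>With second coordinate 0, \<open>x\<close> is the last point of its diagonal
      and \<open>Suc x\<close> opens the next one; otherwise \<open>Suc x\<close> is one step
      further on the same diagonal. The truncated expression
      \<open>1 - (triangle (Suc w) - Suc x)\<close> is 1 in the first situation and 0 in the
      second.\<close>
    case 0
    have eq: "Suc x = prod_encode (0, Suc a)" by (simp add: x 0 prod_encode_def)
    have "triangle (Suc w) \<le> Suc x" by (simp add: w x 0 prod_encode_def)
    then show ?thesis by (simp add: eq w 0 del: triangle_Suc)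
  next
    case (Suc b')
    have eq: "Suc x = prod_encode (Suc a, b')" by (simp add: x Suc prod_encode_def)
    have "Suc x < triangle (Suc w)" by (simp add: w x Suc prod_encode_def)
    then have "1 - (triangle (Suc w) - Suc x) = 0" by simp
    then show ?thesis by (simp add: eq w Suc del: triangle_Suc)
  qed
  then show ?case using Suc by (simp add: w_def)
qed

lemma recursive_on_pfst: "recursive_on n f \<Longrightarrow> recursive_on n (\<lambda>xs. pfst (f xs))"
  and recursive_on_psnd: "recursive_on n f \<Longrightarrow> recursive_on n (\<lambda>xs. psnd (f xs))"
proof -
  assume f: "recursive_on n f"
  have diag: "recursive_on n (\<lambda>xs. pfst (f xs) + psnd (f xs))"
    using recursive_on_rec1[of "\<lambda>k r. r + (1 - (triangle (Suc r) - Suc k))", OF _ f, where b = 0]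
    unfolding pfst_psnd_eq_rec
    by (simp only: recursive_on_proj recursive_on_Suc recursive_on_add recursive_on_diff
        recursive_on_triangle recursive_on_const numeral_2_eq_2 zero_less_Suc lessI One_nat_def)
  have 1: "x - triangle (pfst x + psnd x) = pfst x" for x
    using prod_encode_pfst_psnd[of x] by (simp only: prod_encode_def split_conv)
  show fst: "recursive_on n (\<lambda>xs. pfst (f xs))"
    using recursive_on_diff[OF f recursive_on_triangle[OF diag]] by (simp only: 1)
  show "recursive_on n (\<lambda>xs. psnd (f xs))"
    using recursive_on_diff[OF diag fst] by simp
qed

section \<open>Unary computable functions and decidable predicates\<close>

definition computable :: "(nat \<Rightarrow> nat) \<Rightarrow> bool" where
  "computable f \<longleftrightarrow> recursive_on 1 (\<lambda>xs. f (xs ! 0))"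

text \<open>Packing the arguments into one number removes arities, so that the closure rules for
  unary functions can be chained by \<open>intro\<close>.\<close>

definition computable2 :: "(nat \<Rightarrow> nat \<Rightarrow> nat) \<Rightarrow> bool" where
  "computable2 f \<longleftrightarrow> computable (\<lambda>p. f (pfst p) (psnd p))"

abbreviation decid :: "(nat \<Rightarrow> bool) \<Rightarrow> bool" where
  "decid P \<equiv> computable (\<lambda>x. of_bool (P x))"

lemma decidable_iff: "decidable A \<longleftrightarrow> decid (\<lambda>x. x \<in> A)"
proof -
  have "(\<forall>xs. length xs = 1 \<longrightarrow> P xs) \<longleftrightarrow> (\<forall>x. P [x])" for P :: "nat list \<Rightarrow> bool"
    by (metis One_nat_def length_0_conv length_Cons length_Suc_conv)
  from this[of "\<lambda>xs. f xs = of_bool (xs ! 0 \<in> A)" for f :: "nat list \<Rightarrow> nat"]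
  show ?thesis
    unfolding decidable_def computable_def recursive_on_def by (simp only: nth_Cons_0)
qed

lemma computable_id: "computable (\<lambda>x. x)"
  unfolding computable_def by (simp add: recursive_on_proj)

lemma computable_const: "computable (\<lambda>x. c)"
  unfolding computable_def by (rule recursive_on_const)

lemma computable_comp: "computable f \<Longrightarrow> computable g \<Longrightarrow> computable (\<lambda>x. f (g x))"
  unfolding computable_def by (rule recursive_on_comp1)

lemma computable_Suc: "computable f \<Longrightarrow> computable (\<lambda>x. Suc (f x))"
  unfolding computable_def by (rule recursive_on_Suc)

lemma computable_pfst: "computable f \<Longrightarrow> computable (\<lambda>x. pfst (f x))"
  unfolding computable_def by (rule recursive_on_pfst)

lemma computable_psnd: "computable f \<Longrightarrow> computable (\<lambda>x. psnd (f x))"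
  unfolding computable_def by (rule recursive_on_psnd)

lemma computable_prod_encode:
  "computable f \<Longrightarrow> computable g \<Longrightarrow> computable (\<lambda>x. prod_encode (f x, g x))"
  unfolding computable_def by (rule recursive_on_prod_encode)

lemma computable_add: "computable f \<Longrightarrow> computable g \<Longrightarrow> computable (\<lambda>x. f x + g x)"
  unfolding computable_def by (rule recursive_on_add)

lemma computable_diff: "computable f \<Longrightarrow> computable g \<Longrightarrow> computable (\<lambda>x. f x - g x)"
  unfolding computable_def by (rule recursive_on_diff)

lemma computable_mult: "computable f \<Longrightarrow> computable g \<Longrightarrow> computable (\<lambda>x. f x * g x)"
  unfolding computable_def by (rule recursive_on_mult)

lemma computable2_app:
  "computable2 F \<Longrightarrow> computable f \<Longrightarrow> computable g \<Longrightarrow> computable (\<lambda>x. F (f x) (g x))"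
  using computable_comp[of "\<lambda>p. F (pfst p) (psnd p)" "\<lambda>x. prod_encode (f x, g x)"]
  by (simp only: computable2_def computable_prod_encode pfst_prod_encode psnd_prod_encode)

lemma computable_rec:
  assumes "computable b" "computable (\<lambda>p. s (pfst p) (pfst (psnd p)) (psnd (psnd p)))" "computable m"
  shows "computable (\<lambda>x. rec_nat (b x) (s x) (m x))"
proof -
  have "recursive_on 3 (\<lambda>xs. s (xs ! 2) (xs ! 0) (xs ! 1))"
    using recursive_on_comp1[OF assms(2)[unfolded computable_def],
        of 3 "\<lambda>xs. prod_encode (xs ! 2, prod_encode (xs ! 0, xs ! 1))"]
    by (simp add: recursive_on_prod_encode recursive_on_proj)
  from recursive_on_rec2[of b "\<lambda>k r p. s p k r", OF _ this, of 1 "\<lambda>xs. m (xs ! 0)" "\<lambda>xs. xs ! 0"]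
  show ?thesis
    using assms(1,3) by (simp add: computable_def recursive_on_proj)
qed

lemmas computable_arith = computable_id computable_const computable_Suc computable_pfst computable_psnd
  computable_prod_encode computable_add computable_diff computable_mult

lemma decid_le: "computable f \<Longrightarrow> computable g \<Longrightarrow> decid (\<lambda>x. f x \<le> g x)"
proof -
  assume *: "computable f" "computable g"
  have "of_bool (f x \<le> g x) = 1 - (f x - g x)" for x by simp
  then show ?thesis by (simp only:) (intro computable_arith *)
qed

lemma decid_Not: "decid P \<Longrightarrow> decid (\<lambda>x. \<not> P x)"
proof -
  assume *: "decid P"
  have "of_bool (\<not> P x) = 1 - (of_bool (P x) :: nat)" for x by simp
  then show ?thesis by (simp only:) (intro computable_arith *)
qed

lemma decid_conj: "decid P \<Longrightarrow> decid Q \<Longrightarrow> decid (\<lambda>x. P x \<and> Q x)"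
  unfolding of_bool_conj by (rule computable_mult)

lemma decid_disj: "decid P \<Longrightarrow> decid Q \<Longrightarrow> decid (\<lambda>x. P x \<or> Q x)"
  using decid_Not[OF decid_conj, of "\<lambda>x. \<not> P x" "\<lambda>x. \<not> Q x"] decid_Not[of P] decid_Not[of Q]
  by (simp only: de_Morgan_conj not_not)

lemma decid_imp: "decid P \<Longrightarrow> decid Q \<Longrightarrow> decid (\<lambda>x. P x \<longrightarrow> Q x)"
  unfolding imp_conv_disj by (intro decid_disj decid_Not)

lemma decid_less: "computable f \<Longrightarrow> computable g \<Longrightarrow> decid (\<lambda>x. f x < g x)"
  unfolding less_eq_Suc_le by (intro decid_le computable_Suc)

lemma decid_eq: "computable f \<Longrightarrow> computable g \<Longrightarrow> decid (\<lambda>x. f x = g x)"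
  unfolding eq_iff by (intro decid_conj decid_le)

lemma computable_If:
  "decid P \<Longrightarrow> computable f \<Longrightarrow> computable g \<Longrightarrow> computable (\<lambda>x. if P x then f x else g x)"
proof -
  assume *: "decid P" "computable f" "computable g"
  have "(if P x then f x else g x) = of_bool (P x) * f x + (1 - of_bool (P x)) * g x" for x
    by (cases "P x") simp_all
  then have "(\<lambda>x. if P x then f x else g x)
      = (\<lambda>x. of_bool (P x) * f x + (1 - of_bool (P x)) * g x)"
    by (rule ext)
  moreover have "computable (\<lambda>x. of_bool (P x) * f x + (1 - of_bool (P x)) * g x)"
    by (intro computable_arith *)
  ultimately show ?thesis by metis
qed

lemma computable_sum:
  assumes "computable (\<lambda>p. f (pfst p) (psnd p))" "computable m"
  shows "computable (\<lambda>x. \<Sum>i<m x. f x i)"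
proof -
  have "(\<Sum>i<n. f x i) = rec_nat 0 (\<lambda>k r. r + f x k) n" for x n
    by (induction n) auto
  moreover have "computable (\<lambda>x. rec_nat 0 (\<lambda>k r. r + f x k) (m x))"
    by (intro computable_rec computable_arith computable2_app[of f] assms)
      (simp add: computable2_def assms)
  ultimately show ?thesis by simp
qed

lemma decid_ex:
  assumes "decid (\<lambda>p. P (pfst p) (psnd p))" "computable m"
  shows "decid (\<lambda>x. \<exists>i<m x. P x i)"
proof -
  have "(\<exists>i<m x. P x i) \<longleftrightarrow> 0 < (\<Sum>i<m x. of_bool (P x i) :: nat)" for x
    by (auto simp: sum_eq_0_iff simp flip: neq0_conv)
  then show ?thesis
    by (simp only:) (intro decid_less computable_const computable_sum assms)
qed

lemma decid_all:
  assumes "decid (\<lambda>p. P (pfst p) (psnd p))" "computable m"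
  shows "decid (\<lambda>x. \<forall>i<m x. P x i)"
  using decid_Not[OF decid_ex[OF decid_Not[OF assms(1)] assms(2)]] by simp

section \<open>Powers of two, and finite sets coded by binary numerals\<close>

lemma computable_power: "computable f \<Longrightarrow> computable (\<lambda>x. 2 ^ f x)"
proof -
  assume f: "computable f"
  have "(2 :: nat) ^ n = rec_nat 1 (\<lambda>k r. 2 * r) n" for n
    by (induction n) auto
  then show ?thesis
    by (simp only:) (intro computable_rec computable_arith f)
qed

text \<open>The odd quotient of \<open>n\<close> by \<open>2 ^ i\<close> is expressed by bounded
  quantifiers over sums, products and powers, for which closure rules are available; division never
  has to be shown computable.\<close>

lemma in_set_decode_iff:
  "i \<in> set_decode n \<longleftrightarrow> (\<exists>q<Suc n. \<exists>r<2 ^ i. n = (2 * q + 1) * 2 ^ i + r)"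
proof
  assume "i \<in> set_decode n"
  then have "odd (n div 2 ^ i)" by (simp add: set_decode_def)
  then obtain q where q: "n div 2 ^ i = 2 * q + 1" by (rule oddE)
  have n: "n = (2 * q + 1) * 2 ^ i + n mod 2 ^ i"
    by (metis q div_mult_mod_eq)
  moreover have "q < Suc n"
    using q div_le_dividend[of n "2 ^ i"] by linarith
  ultimately show "\<exists>q<Suc n. \<exists>r<2 ^ i. n = (2 * q + 1) * 2 ^ i + r"
    by (metis mod_less_divisor zero_less_numeral zero_less_power)
next
  assume "\<exists>q<Suc n. \<exists>r<2 ^ i. n = (2 * q + 1) * 2 ^ i + r"
  then obtain q r where "r < 2 ^ i" "n = (2 * q + 1) * 2 ^ i + r" by blast
  then have "n div 2 ^ i = 2 * q + 1" by (simp add: div_mult_self3 del: mult_Suc)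
  then show "i \<in> set_decode n" by (simp add: set_decode_def)
qed

lemma decid_in_set_decode:
  assumes "computable f" "computable g"
  shows "decid (\<lambda>x. f x \<in> set_decode (g x))"
proof -
  have "computable2 (\<lambda>i n. of_bool (i \<in> set_decode n))"
    unfolding computable2_def in_set_decode_iff
    by (intro decid_ex decid_eq computable_power computable_arith)
  from computable2_app[OF this assms] show ?thesis .
qed

lemma set_encode_bounded: "set_encode {i. i < n \<and> P i} = (\<Sum>i<n. of_bool (P i) * 2 ^ i)"
proof -
  have "{i. i < n \<and> P i} = {i \<in> {..<n}. P i}" by auto
  then show ?thesis
    unfolding set_encode_def by (simp only: sum.inter_filter finite_lessThan) (intro sum.cong, simp_all)
qed

lemma computable_set_encode:
  assumes "decid (\<lambda>p. P (pfst p) (psnd p))" "computable m"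
  shows "computable (\<lambda>x. set_encode {i. i < m x \<and> P x i})"
  unfolding set_encode_bounded
  by (intro computable_sum computable_mult computable_power computable_arith assms)

text \<open>From \<open>2 ^ i \<le> n\<close>. Every quantifier over the elements of a coded set can
  thus be bounded by the code itself.\<close>

lemma in_set_decode_less: "i \<in> set_decode n \<Longrightarrow> i < n"
proof -
  assume "i \<in> set_decode n"
  then have "2 ^ i \<le> n"
    by (metis empty_subsetI finite_set_decode insert_subset set_encode_insert set_encode_empty
        add.right_neutral empty_iff finite.emptyI set_encode_inverse set_decode_inverse
        subset_decode_imp_le finite_insert)
  then show ?thesis using less_exp[of i] by linarith
qed

lemmas computable_intros = computable_arith computable_power computable_If computable_sum
  computable_set_encode decid_le decid_less decid_eq decid_Not decid_conj decid_disj decid_imp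
  decid_ex decid_all decid_in_set_decode

section \<open>Recursion on codes with a changing second argument\<close>

definition table_lookup :: "nat \<Rightarrow> nat \<Rightarrow> nat \<Rightarrow> nat" where
  "table_lookup T c x = (\<Sum>v<T. of_bool (prod_encode (prod_encode (c, x), v) \<in> set_decode T) * v)"

lemma computable_table_lookup:
  "computable T \<Longrightarrow> computable c \<Longrightarrow> computable x \<Longrightarrow> computable (\<lambda>z. table_lookup (T z) (c z) (x z))"
proof -
  have "computable (\<lambda>z. table_lookup (pfst z) (pfst (psnd z)) (psnd (psnd z)))"
    unfolding table_lookup_def by (intro computable_intros)
  from computable_comp[OF this, of "\<lambda>z. prod_encode (T z, prod_encode (c z, x z))"]
  show "computable T \<Longrightarrow> computable c \<Longrightarrow> computable x \<Longrightarrow> ?thesis"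
    by (simp add: computable_prod_encode)
qed

text \<open>If the set coded by \<open>T\<close> contains at most one value for the given arguments,
  the sum has at most one nonzero summand, and a missing entry reads as 0. The range of the sum is
  large enough because an element of the set is below \<open>T\<close> and a pair is at least its
  components.\<close>

lemma table_lookup_eq:
  assumes "\<And>v. prod_encode (prod_encode (c, x), v) \<in> set_decode T \<longleftrightarrow> P \<and> v = F"
  shows "table_lookup T c x = (if P then F else 0)"
proof (cases P)
  case True
  then have "prod_encode (prod_encode (c, x), F) < T"
    using assms in_set_decode_less by blast
  then have "F < T" using le_prod_encode_2[of F] le_less_trans by blast
  then show ?thesis
    using True unfolding table_lookup_def assms
    by (simp add: of_bool_def if_distrib[of "\<lambda>a. a * _"] cong: if_cong)
next
  case False
  then show ?thesis unfolding table_lookup_def assms by simp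
qed

text \<open>\<open>F\<close> is computed from finite tables of its values at second arguments up to a bound \<open>K\<close>; enlarging
  \<open>x\<close> by \<open>B\<close> once for each step of the recursion gives a \<open>K\<close> for which no value is missing.\<close>

lemma computable_nested_recursion:
  fixes H :: "nat \<Rightarrow> nat \<Rightarrow> (nat \<Rightarrow> nat \<Rightarrow> nat) \<Rightarrow> nat"
  assumes H: "computable (\<lambda>p. H (pfst p) (pfst (psnd p)) (table_lookup (psnd (psnd p))))"
    and B: "computable (\<lambda>p. B (pfst p) (psnd p))"
  shows "\<exists>F. computable2 F \<and>
    (\<forall>c x. F c x = H c x (\<lambda>d y. if d < c \<and> y \<le> B c x then F d y else 0))"
proof -
  \<comment> \<open>Entries with second argument above the permitted bound are removed before
    \<open>H\<close> receives the table; otherwise the value of \<open>H\<close> would depend on how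
    far the table happens to extend.\<close>
  define filt where "filt b T = set_encode {z. z < T \<and> z \<in> set_decode T \<and> psnd (pfst z) \<le> b}" for b T
  have filt: "set_decode (filt b T) = {z \<in> set_decode T. psnd (pfst z) \<le> b}" for b T
    unfolding filt_def using in_set_decode_less by (subst set_encode_inverse) auto
  define val where "val c y T = H c y (table_lookup (filt (B c y) T))" for c y T
  define step where
    "step K c T = T + (\<Sum>y<Suc K. 2 ^ prod_encode (prod_encode (c, y), val c y T))" for K c T
  define tab where "tab K c = rec_nat 0 (step K) c" for K c
  \<comment> \<open>\<open>G K\<close> is the approximation in which a call with second argument
    above \<open>K\<close> returns 0, as its recursion equation below makes explicit.\<close>
  define G where "G K c y = val c y (tab K c)" for K c y
  have tab_0: "tab K 0 = 0" for K by (simp add: tab_def)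
  have tab_Suc: "tab K (Suc c) = tab K c + (\<Sum>y<Suc K. 2 ^ prod_encode (prod_encode (c, y), G K c y))"
    for K c by (simp add: tab_def step_def G_def)
  have tab_sum: "tab K c = (\<Sum>d<c. \<Sum>y<Suc K. 2 ^ prod_encode (prod_encode (d, y), G K d y))" for K c
    by (induction c) (simp_all only: tab_0 tab_Suc sum.lessThan_Suc lessThan_0 sum.empty)
  define entry where "entry K = (\<lambda>(d, y). prod_encode (prod_encode (d, y), G K d y))" for K
  have "tab K c = set_encode (entry K ` ({..<c} \<times> {..<Suc K}))" for K c
  proof -
    \<comment> \<open>Distinct arguments have distinct entries, so the powers of two add up without
      carries and the sum is the code of the set of entries.\<close>
    have "inj_on (entry K) A" for A by (auto simp: inj_on_def entry_def)
    then show ?thesis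
      unfolding set_encode_def by (simp only: sum.reindex)
        (simp add: tab_sum sum.cartesian_product entry_def case_prod_unfold del: sum.lessThan_Suc)
  qed
  then have "set_decode (tab K c) = entry K ` ({..<c} \<times> {..<Suc K})" for K c
    by (simp del: lessThan_Suc)
  then have "prod_encode (prod_encode (d, y), v) \<in> set_decode (filt b (tab K c)) \<longleftrightarrow>
      (d < c \<and> y \<le> K \<and> y \<le> b) \<and> v = G K d y" for d y v b K c
    unfolding filt entry_def by auto
  then have "table_lookup (filt b (tab K c)) =
      (\<lambda>d y. if d < c \<and> y \<le> K \<and> y \<le> b then G K d y else 0)" for b K c
    by (intro ext table_lookup_eq)
  then have G: "G K c x = H c x (\<lambda>d y. if d < c \<and> y \<le> K \<and> y \<le> B c x then G K d y else 0)" for K c x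
    by (simp add: G_def val_def)
  \<comment> \<open>Summing replaces a maximum: \<open>M\<close> dominates \<open>x\<close> and
    \<open>B c x\<close> and is monotone in both arguments, which \<open>B\<close> need not
    be.\<close>
  define M where "M c x = x + (\<Sum>d<Suc c. \<Sum>y<Suc x. B d y)" for c x
  have M_ge: "x \<le> M c x" for c x by (simp add: M_def)
  have B_le: "B c x \<le> M c x" for c x
  proof -
    have "B c x \<le> (\<Sum>y<Suc x. B c y)"
      by (rule member_le_sum) auto
    also have "\<dots> \<le> (\<Sum>d<Suc c. \<Sum>y<Suc x. B d y)"
      by (rule member_le_sum[where f = "\<lambda>d. \<Sum>y<Suc x. B d y"]) auto
    finally show ?thesis by (simp add: M_def)
  qed
  have M_mono: "M c x \<le> M d y" if "c \<le> d" "x \<le> y" for c d x y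
  proof -
    have "(\<Sum>i<Suc c. \<Sum>j<Suc x. B i j) \<le> (\<Sum>i<Suc d. \<Sum>j<Suc x. B i j)"
      using that by (intro sum_mono2) auto
    also have "\<dots> \<le> (\<Sum>i<Suc d. \<Sum>j<Suc y. B i j)"
      using that by (intro sum_mono sum_mono2) auto
    finally show ?thesis using that by (simp only: M_def add_mono)
  qed
  \<comment> \<open>A chain of calls starting from \<open>(c, x)\<close> has length at most
    \<open>c\<close>, because the first argument decreases, and each call takes the second argument
    at most to its image under \<open>M c\<close>.\<close>
  define N where "N c x = (M c ^^ c) x" for c x
  have iter_mono: "(M c ^^ k) x \<le> (M d ^^ l) y" if "c \<le> d" "x \<le> y" "k \<le> l" for c d x y k l
  proof -
    have "(M c ^^ k) x \<le> (M d ^^ k) y"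
      by (induction k) (use that M_mono in auto)
    also have "\<dots> \<le> (M d ^^ l) y"
      using \<open>k \<le> l\<close> by (induction rule: dec_induct) (auto intro: order_trans[OF _ M_ge])
    finally show ?thesis .
  qed
  have N_ge: "x \<le> N c x" for c x
    using iter_mono[of c c x x 0 c] by (simp add: N_def)
  have N_step: "N d y \<le> N c x" if "d < c" "y \<le> B c x" for c d x y
  proof -
    obtain c' where c: "c = Suc c'" "d \<le> c'" using \<open>d < c\<close> by (cases c) auto
    have "N d y \<le> (M c ^^ c') (M c x)"
      unfolding N_def using that c B_le[of c x] by (intro iter_mono) auto
    then show ?thesis by (simp add: N_def c funpow_swap1)
  qed
  \<comment> \<open>Once \<open>K\<close> reaches \<open>N c x\<close>, the cut-off at
    \<open>K\<close> affects no call, so the approximations agree. This is why taking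
    \<open>K = N c x\<close> yields a solution of the equation without cut-off.\<close>
  have stable: "G K c x = G K' c x" if "N c x \<le> K" "N c x \<le> K'" for K K' c x
    using that
  proof (induction c arbitrary: x rule: less_induct)
    case (less c)
    have "(\<lambda>d y. if d < c \<and> y \<le> K \<and> y \<le> B c x then G K d y else 0) =
        (\<lambda>d y. if d < c \<and> y \<le> K' \<and> y \<le> B c x then G K' d y else 0)"
    proof (intro ext)
      fix d y
      show "(if d < c \<and> y \<le> K \<and> y \<le> B c x then G K d y else 0) =
          (if d < c \<and> y \<le> K' \<and> y \<le> B c x then G K' d y else 0)"
        using N_step[of d c y x] N_ge[of y d] less by (auto intro: less.IH)
    qed
    then show ?case by (simp only: G[of K c x] G[of K' c x])
  qed
  define F where "F c x = G (N c x) c x" for c x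
  have F_eq: "F c x = H c x (\<lambda>d y. if d < c \<and> y \<le> B c x then F d y else 0)" for c x
  proof -
    have "(\<lambda>d y. if d < c \<and> y \<le> N c x \<and> y \<le> B c x then G (N c x) d y else 0) =
        (\<lambda>d y. if d < c \<and> y \<le> B c x then F d y else 0)"
    proof (intro ext)
      fix d y
      show "(if d < c \<and> y \<le> N c x \<and> y \<le> B c x then G (N c x) d y else 0) =
          (if d < c \<and> y \<le> B c x then F d y else 0)"
        using N_step[of d c y x] N_ge[of y d] by (auto simp: F_def intro: stable)
    qed
    then show ?thesis by (simp only: F_def[of c x] G[of "N c x" c x])
  qed
  have B_app: "computable (\<lambda>p. B (f p) (g p))" if "computable f" "computable g" for f g
    using computable2_app[of B f g] B that by (simp add: computable2_def)
  have c_filt: "computable (\<lambda>p. filt (f p) (g p))" if "computable f" "computable g" for f g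
  proof (rule computable2_app[where F = filt, OF _ that])
    show "computable2 filt"
      unfolding computable2_def filt_def by (intro computable_intros)
  qed
  have c_val: "computable (\<lambda>p. val (f p) (g p) (h p))"
    if "computable f" "computable g" "computable h" for f g h
    unfolding val_def
    using computable_comp[OF H, of "\<lambda>p. prod_encode (f p, prod_encode (g p, filt (B (f p) (g p)) (h p)))"]
      c_filt B_app that by (simp add: computable_prod_encode)
  have c_tab: "computable (\<lambda>p. tab (f p) (g p))" if "computable f" "computable g" for f g
  proof (rule computable2_app[where F = tab, OF _ that])
    show "computable2 tab"
      unfolding computable2_def tab_def step_def
      by (intro computable_rec computable_intros c_val)
  qed
  have c_iter: "computable (\<lambda>p. N (f p) (g p))" if "computable f" "computable g" for f g
  proof (rule computable2_app[where F = N, OF _ that])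
    have "(m ^^ k) x = rec_nat x (\<lambda>_. m) k" for m k and x :: nat
      by (induction k) auto
    then show "computable2 N"
      unfolding computable2_def N_def M_def
      by (simp only:) (intro computable_rec computable_intros B_app)
  qed
  have "computable2 F"
    unfolding computable2_def F_def G_def
    by (intro c_val c_tab c_iter computable_intros)
  with F_eq show ?thesis by blast
qed

section \<open>Eventually periodic orbits\<close>

text \<open>Among the times \<open>0, ..., card A\<close> two carry the same value. The smaller one
  serves as preperiod and the difference as period, so their sum is the larger time, at most
  \<open>card A\<close>.\<close>

lemma orbit_ultimately_periodic:
  assumes step: "\<And>k. x (Suc k) = f (x k)" and "\<And>k. x k \<in> A" "finite A"
  obtains p q where "q > 0" "p + q \<le> card A" "\<And>k. k \<ge> p \<Longrightarrow> x (k + q) = x k"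
proof -
  have "card A < card {..card A}" by simp
  moreover have "x ` {..card A} \<subseteq> A" using assms(2) by blast
  ultimately have "\<not> inj_on x {..card A}"
    using card_inj_on_le[of x "{..card A}" A] assms(3) by linarith
  then obtain i j where "i \<noteq> j" "x i = x j" "i \<le> card A" "j \<le> card A"
    unfolding inj_on_def by auto
  then obtain p q where pq: "q > 0" "x (p + q) = x p" "p + q \<le> card A"
  proof (cases "i < j")
    case True
    with \<open>x i = x j\<close> \<open>j \<le> card A\<close> that[of "j - i" i] show thesis by simp
  next
    case False
    with \<open>i \<noteq> j\<close> \<open>x i = x j\<close> \<open>i \<le> card A\<close> that[of "i - j" j] show thesis by simp
  qed
  have "x (k + q) = x k" if "k \<ge> p" for k
    using that by (induction rule: dec_induct) (simp_all add: pq step)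
  with pq that show thesis by blast
qed

text \<open>A time from \<open>card A\<close> onwards is at least \<open>p + q\<close>, so
  subtracting the period \<open>q\<close> stays in the periodic part. Later this bounds the search
  through the powers of a semigroup element.\<close>

lemma orbit_value_bounded:
  assumes step: "\<And>k. x (Suc k) = f (x k)" and "\<And>k. x k \<in> A" "finite A"
  shows "\<exists>i<card A. x k = x i"
proof -
  obtain p q where pq: "q > 0" "p + q \<le> card A" "\<And>k. k \<ge> p \<Longrightarrow> x (k + q) = x k"
    using orbit_ultimately_periodic[of x f, OF assms] by blast
  show ?thesis
  proof (induction k rule: less_induct)
    case (less k)
    show ?case
    proof (cases "k < card A")
      case False
      with pq have "x k = x (k - q)" "k - q < k"
        using pq(3)[of "k - q"] by simp_all
      with less show ?thesis by metis
    qed blast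
  qed
qed

section \<open>Recognisers of \<omega>-languages\<close>

text \<open>The product \<open>g i ... g (j - 1)\<close>, bracketed to the left. The semigroups have
  no unit, so only nonempty segments, \<open>i < j\<close>, are meaningful; the other values are
  fillers.\<close>

primrec seg :: "(nat \<Rightarrow> nat \<Rightarrow> nat) \<Rightarrow> (nat \<Rightarrow> nat) \<Rightarrow> nat \<Rightarrow> nat \<Rightarrow> nat" where
  "seg m g i 0 = 0"
| "seg m g i (Suc j) = (if i < j then m (seg m g i j) (g j) else g j)"

lemma seg_single [simp]: "seg m g i (Suc i) = g i"
  by simp

declare seg.simps(2) [simp del]

lemma seg_Suc: "i < j \<Longrightarrow> seg m g i (Suc j) = m (seg m g i j) (g j)"
  by (simp add: seg.simps)

lemma seg_induct [consumes 1, case_names single Suc]: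
  assumes "i < j" "P (Suc i)" "\<And>j. i < j \<Longrightarrow> P j \<Longrightarrow> P (Suc j)"
  shows "P j"
proof -
  have "Suc i \<le> j" using assms(1) by simp
  then show ?thesis
    by (induction rule: dec_induct) (use assms(2,3) in auto)
qed

lemma seg_cong:
  assumes "i < j" "\<And>t. i \<le> t \<Longrightarrow> t < j \<Longrightarrow> g t = g' t"
  shows "seg m g i j = seg m g' i j"
  using assms by (induction rule: seg_induct) (simp_all add: seg_Suc)

lemma seg_append:
  assumes "\<And>s t u. m (m s t) u = m s (m t u)" "i < j" "j < k"
  shows "seg m g i k = m (seg m g i j) (seg m g j k)"
  using assms(3) by (induction rule: seg_induct) (use assms(1,2) in \<open>simp_all add: seg_Suc\<close>)

lemma seg_seg:
  assumes "\<And>s t u. m (m s t) u = m s (m t u)" "strict_mono f" "i < j"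
  shows "seg m g (f i) (f j) = seg m (\<lambda>n. seg m g (f n) (f (Suc n))) i j"
  using assms(3)
proof (induction rule: seg_induct)
  case (Suc j)
  then show ?case
    using seg_append[of m "f i" "f j" "f (Suc j)" g] assms(1,2)
    by (simp add: seg_Suc strict_mono_less)
qed simp

text \<open>In the absence of a unit the exponent is shifted: \<open>op_power m e n\<close> is the
  product of \<open>n + 1\<close> factors \<open>e\<close>.\<close>

primrec op_power :: "(nat \<Rightarrow> nat \<Rightarrow> nat) \<Rightarrow> nat \<Rightarrow> nat \<Rightarrow> nat" where
  "op_power m e 0 = e"
| "op_power m e (Suc n) = m (op_power m e n) e"

lemma seg_const:
  "(\<And>t. i \<le> t \<Longrightarrow> g t = e) \<Longrightarrow> seg m g i (Suc (i + n)) = op_power m e n"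
  by (induction n) (simp_all add: seg_Suc)

text \<open>\<open>s\<close> and \<open>e\<close> are the types of the blocks of a factorisation \<open>u v\<^sub>1 v\<^sub>2 \<dots>\<close> of the word in which all
  the \<open>v\<^sub>n\<close> have the same type.\<close>

definition recognises ::
  "('l \<Rightarrow> nat) \<Rightarrow> (nat \<Rightarrow> nat \<Rightarrow> nat) \<Rightarrow> (nat \<Rightarrow> nat \<Rightarrow> bool) \<Rightarrow> nat \<Rightarrow> ((nat \<Rightarrow> 'l) \<Rightarrow> bool) \<Rightarrow> bool" where
  "recognises h m ac b L \<longleftrightarrow>
     (\<forall>w i j. i < j \<longrightarrow> seg m (\<lambda>t. h (w t)) i j < b) \<and>
     (\<forall>s t u. m (m s t) u = m s (m t u)) \<and>
     (\<forall>w f s e. strict_mono f \<longrightarrow> f 0 = 0 \<longrightarrow> seg m (\<lambda>t. h (w t)) 0 (f 1) = s \<longrightarrow>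
        (\<forall>n\<ge>1. seg m (\<lambda>t. h (w t)) (f n) (f (Suc n)) = e) \<longrightarrow> (L w \<longleftrightarrow> ac s e))"

lemma recognisesI:
  assumes "\<And>w i j. i < j \<Longrightarrow> seg m (\<lambda>t. h (w t)) i j < b"
    and "\<And>s t u. m (m s t) u = m s (m t u)"
    and "\<And>w f s e. strict_mono f \<Longrightarrow> f 0 = 0 \<Longrightarrow> seg m (\<lambda>t. h (w t)) 0 (f 1) = s \<Longrightarrow>
        (\<And>n. n \<ge> 1 \<Longrightarrow> seg m (\<lambda>t. h (w t)) (f n) (f (Suc n)) = e) \<Longrightarrow> L w \<longleftrightarrow> ac s e"
  shows "recognises h m ac b L"
  using assms unfolding recognises_def by blast

lemma recognises_less: "recognises h m ac b L \<Longrightarrow> i < j \<Longrightarrow> seg m (\<lambda>t. h (w t)) i j < b"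
  and recognises_assoc: "recognises h m ac b L \<Longrightarrow> m (m s t) u = m s (m t u)"
  unfolding recognises_def by simp_all

lemma recognises_iff:
  assumes "recognises h m ac b L" "strict_mono f" "f 0 = 0"
    and "seg m (\<lambda>t. h (w t)) 0 (f 1) = s"
    and "\<And>n. n \<ge> 1 \<Longrightarrow> seg m (\<lambda>t. h (w t)) (f n) (f (Suc n)) = e"
  shows "L w \<longleftrightarrow> ac s e"
  using assms(1)[unfolded recognises_def, THEN conjunct2, THEN conjunct2, rule_format, OF assms(2-5)] .

lemma strict_mono_block:
  fixes f :: "nat \<Rightarrow> nat"
  assumes "strict_mono f" "f 0 = 0"
  obtains n where "f n \<le> t" "t < f (Suc n)"
proof -
  have "\<exists>n. t < f (Suc n)"
    using strict_mono_imp_increasing[OF assms(1), of "Suc t"] by (auto simp: Suc_le_eq)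
  then have "t < f (Suc (LEAST n. t < f (Suc n)))" by (rule LeastI_ex)
  moreover have "f (LEAST n. t < f (Suc n)) \<le> t"
  proof (cases "LEAST n. t < f (Suc n)")
    case (Suc k)
    then have "\<not> t < f (Suc k)" using not_less_Least[of k "\<lambda>n. t < f (Suc n)"] by simp
    then show ?thesis using Suc by simp
  qed (simp add: assms)
  ultimately show thesis using that by blast
qed

text \<open>Acceptance is an equivalence for every factorisation into blocks of equal type, so
  complementing the accepted pairs is enough. With nondeterministic automata this would be the hard
  step.\<close>

lemma recognises_Neg:
  assumes "recognises h m ac b L"
  shows "recognises h m (\<lambda>s e. \<not> ac s e) b (\<lambda>w. \<not> L w)"
  by (rule recognisesI)
    (simp_all add: recognises_less[OF assms] recognises_assoc[OF assms] recognises_iff[OF assms])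

definition pair_op :: "(nat \<Rightarrow> nat \<Rightarrow> nat) \<Rightarrow> (nat \<Rightarrow> nat \<Rightarrow> nat) \<Rightarrow> nat \<Rightarrow> nat \<Rightarrow> nat" where
  "pair_op m m' s t = prod_encode (m (pfst s) (pfst t), m' (psnd s) (psnd t))"

lemma seg_pair_op:
  "i < j \<Longrightarrow> seg (pair_op m m') (\<lambda>t. prod_encode (g t, g' t)) i j
    = prod_encode (seg m g i j, seg m' g' i j)"
  by (induction rule: seg_induct) (simp_all add: seg_Suc pair_op_def)

lemma recognises_Conj:
  assumes "recognises h m ac b L" "recognises h' m' ac' b' L'"
  shows "recognises (\<lambda>a. prod_encode (h a, h' a)) (pair_op m m')
    (\<lambda>s e. ac (pfst s) (pfst e) \<and> ac' (psnd s) (psnd e)) (prod_encode (b, b')) (\<lambda>w. L w \<and> L' w)"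
proof (rule recognisesI, goal_cases)
  case (1 w i j)
  then show ?case
    using assms by (simp add: seg_pair_op prod_encode_less recognises_less)
next
  case (2 s t u)
  show ?case
    using assms by (simp add: pair_op_def recognises_assoc)
next
  case (3 w f s e)
  have mono: "f n < f (Suc n)" for n using 3(1) by (simp add: strict_mono_less)
  have 0: "0 < f 1" using mono[of 0] 3(2) by simp
  have s: "s = prod_encode (seg m (\<lambda>t. h (w t)) 0 (f 1), seg m' (\<lambda>t. h' (w t)) 0 (f 1))"
    using 3(3) 0 by (simp add: seg_pair_op)
  have e: "e = prod_encode (seg m (\<lambda>t. h (w t)) (f n) (f (Suc n)),
      seg m' (\<lambda>t. h' (w t)) (f n) (f (Suc n)))" if "n \<ge> 1" for n
    using 3(4)[OF that] mono by (simp add: seg_pair_op)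
  have "L w \<longleftrightarrow> ac (pfst s) (pfst e)"
    by (rule recognises_iff[OF assms(1) 3(1,2)]) (simp add: s, metis e pfst_prod_encode)
  moreover have "L' w \<longleftrightarrow> ac' (psnd s) (psnd e)"
    by (rule recognises_iff[OF assms(2) 3(1,2)]) (simp add: s, metis e psnd_prod_encode)
  ultimately show ?case by simp
qed

section \<open>The languages of the atomic formulas, and uniqueness of an occurrence\<close>

definition and_op :: "nat \<Rightarrow> nat \<Rightarrow> nat" where
  "and_op s t = of_bool (s \<noteq> 0 \<and> t \<noteq> 0)"

lemma seg_and_op:
  "i < j \<Longrightarrow> seg and_op (\<lambda>t. of_bool (P t)) i j = of_bool (\<forall>t. i \<le> t \<and> t < j \<longrightarrow> P t)"
  by (induction rule: seg_induct) (auto simp: seg_Suc and_op_def less_Suc_eq)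

text \<open>Every position lies in some block, and the blocks after the first share one type, so
  testing the first block and that type covers all positions.\<close>

lemma recognises_all:
  "recognises (\<lambda>a. of_bool (P a)) and_op (\<lambda>s e. s \<noteq> 0 \<and> e \<noteq> 0) 2 (\<lambda>w. \<forall>t. P (w t))"
proof (rule recognisesI, goal_cases)
  case (3 w f s e)
  have mono: "f n < f (Suc n)" for n using 3(1) by (simp add: strict_mono_less)
  have 0: "0 < f 1" using mono[of 0] 3(2) by simp
  have s: "s \<noteq> 0 \<longleftrightarrow> (\<forall>t. t < f 1 \<longrightarrow> P (w t))"
    using 3(3) 0 by (auto simp: seg_and_op)
  have e: "e \<noteq> 0 \<longleftrightarrow> (\<forall>t. f n \<le> t \<and> t < f (Suc n) \<longrightarrow> P (w t))" if "n \<ge> 1" for n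
    using 3(4)[OF that] mono by (auto simp: seg_and_op)
  show ?case
  proof
    assume "\<forall>t. P (w t)"
    then show "s \<noteq> 0 \<and> e \<noteq> 0" using s e[of 1] by simp
  next
    assume se: "s \<noteq> 0 \<and> e \<noteq> 0"
    show "\<forall>t. P (w t)"
    proof
      fix t
      obtain n where "f n \<le> t" "t < f (Suc n)" using strict_mono_block 3(1,2) by blast
      then show "P (w t)" using s e[of n] se by (cases n) auto
    qed
  qed
qed (auto simp: seg_and_op and_op_def)

text \<open>Counting occurrences up to "two or more", which is all that uniqueness needs.\<close>

definition count_op :: "nat \<Rightarrow> nat \<Rightarrow> nat" where
  "count_op s t = min 2 (s + t)"

lemma seg_count_op:
  "i < j \<Longrightarrow> seg count_op (\<lambda>t. of_bool (P t)) i j = min 2 (card {t. i \<le> t \<and> t < j \<and> P t})"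
proof (induction rule: seg_induct)
  case single
  have "{t. i \<le> t \<and> t < Suc i \<and> P t} = (if P i then {i} else {})"
    by (auto simp: less_Suc_eq)
  then show ?case by simp
next
  case (Suc j)
  have "{t. i \<le> t \<and> t < Suc j \<and> P t}
      = (if P j then insert j {t. i \<le> t \<and> t < j \<and> P t} else {t. i \<le> t \<and> t < j \<and> P t})"
    using Suc(1) by (auto simp: less_Suc_eq)
  then show ?case using Suc by (auto simp: seg_Suc count_op_def min_def)
qed

text \<open>All blocks after the first have the same type, so an occurrence in one of them would
  recur in each of them. A unique occurrence must therefore sit in the first block, whence
  \<open>s = 1\<close> and \<open>e = 0\<close>.\<close>

lemma recognises_ex1:
  "recognises (\<lambda>a. of_bool (P a)) count_op (\<lambda>s e. s = 1 \<and> e = 0) 3 (\<lambda>w. \<exists>!t. P (w t))"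
proof (rule recognisesI, goal_cases)
  case (3 w f s e)
  define block where "block n = {t. f n \<le> t \<and> t < f (Suc n) \<and> P (w t)}" for n
  have mono: "f n < f (Suc n)" for n using 3(1) by (simp add: strict_mono_less)
  have 0: "0 < f 1" using mono[of 0] 3(2) by simp
  have fin: "finite (block n)" for n by (simp add: block_def)
  have "s = min 2 (card (block 0))"
    using 3(2,3) 0 by (simp add: seg_count_op block_def)
  then have s: "s = 1 \<longleftrightarrow> (\<exists>t. block 0 = {t})"
    using card_1_singleton_iff[of "block 0"] by auto
  have "e = min 2 (card (block n))" if "n \<ge> 1" for n
    using 3(4)[OF that] mono by (simp add: seg_count_op block_def)
  then have "e = 0 \<longleftrightarrow> card (block n) = 0" if "n \<ge> 1" for n
    using that by (simp add: min_def)
  then have e: "e = 0 \<longleftrightarrow> block n = {}" if "n \<ge> 1" for n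
    using that fin[of n] by simp
  have blocks: "\<exists>n. t \<in> block n" if "P (w t)" for t
    using strict_mono_block[OF 3(1,2), of t] that unfolding block_def by blast
  show ?case
  proof
    assume "\<exists>!t. P (w t)"
    then obtain t where t: "P (w t)" "\<And>u. P (w u) \<Longrightarrow> u = t" by blast
    have sub: "block n \<subseteq> {t}" for n using t(2) by (auto simp: block_def)
    obtain n where n: "t \<in> block n" using blocks[OF t(1)] by blast
    \<comment> \<open>The block after the one containing the occurrence is empty. It has index at
      least 1, so it shows \<open>e = 0\<close>; then all blocks of positive index are empty and
      \<open>n\<close> can only be 0.\<close>
    have "t \<notin> block (Suc n)" using n by (simp add: block_def)
    then have "block (Suc n) = {}" using sub[of "Suc n"] by auto
    then have "e = 0" using e[of "Suc n"] by simp
    moreover have "n = 0" using e[of n] \<open>e = 0\<close> n by (cases n) auto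
    then have "block 0 = {t}" using n sub[of 0] by auto
    ultimately show "s = 1 \<and> e = 0" using s by blast
  next
    assume "s = 1 \<and> e = 0"
    then obtain t where t: "block 0 = {t}" and "\<And>n. n \<ge> 1 \<Longrightarrow> block n = {}"
      using s e by blast
    then have "u = t" if "P (w u)" for u
      using blocks[OF that] by (metis One_nat_def Suc_leI empty_iff neq0_conv singletonD)
    moreover have "P (w t)" using t by (auto simp: block_def)
    ultimately show "\<exists>!t. P (w t)" by blast
  qed
qed (auto simp: seg_count_op count_op_def)

text \<open>A segment is summarised by a flag "correct inside", by \<open>Q\<close> at its first and
  by \<open>P\<close> at its last position. Concatenation has exactly one new adjacent pair to
  check, the last position of \<open>s\<close> against the first of \<open>t\<close>.\<close>

definition succ_op :: "nat \<Rightarrow> nat \<Rightarrow> nat" where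
  "succ_op s t = prod_encode (of_bool (pfst s \<noteq> 0 \<and> pfst t \<noteq> 0 \<and> psnd (psnd s) = pfst (psnd t)),
     prod_encode (pfst (psnd s), psnd (psnd t)))"

lemma seg_succ_op:
  "i < j \<Longrightarrow> seg succ_op (\<lambda>t. prod_encode (1, prod_encode (of_bool (Q t), of_bool (P t)))) i j =
     prod_encode (of_bool (\<forall>t. i \<le> t \<and> Suc t < j \<longrightarrow> Q (Suc t) = P t),
       prod_encode (of_bool (Q i), of_bool (P (j - 1))))"
proof (induction rule: seg_induct)
  case (Suc j)
  have "i \<le> t \<and> Suc t < Suc j \<longleftrightarrow> (i \<le> t \<and> Suc t < j) \<or> t = j - 1" for t
    using Suc(1) by auto
  then have "(\<forall>t. i \<le> t \<and> Suc t < Suc j \<longrightarrow> Q (Suc t) = P t) \<longleftrightarrow>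
      (\<forall>t. i \<le> t \<and> Suc t < j \<longrightarrow> Q (Suc t) = P t) \<and> Q (Suc (j - 1)) = P (j - 1)"
    by (simp only:) blast
  moreover have "Suc (j - 1) = j" using Suc(1) by simp
  ultimately have "(\<forall>t. i \<le> t \<and> Suc t < Suc j \<longrightarrow> Q (Suc t) = P t) \<longleftrightarrow>
      (\<forall>t. i \<le> t \<and> Suc t < j \<longrightarrow> Q (Suc t) = P t) \<and> P (j - 1) = Q j"
    by auto
  then show ?case using Suc by (auto simp: seg_Suc succ_op_def)
qed simp

text \<open>\<open>Q\<close> is to be \<open>P\<close> shifted by one. Adjacent positions lie inside
  the first block, inside a later block, across the first border, or across a border between two
  later blocks; the accepting condition has one conjunct for each of these cases and one for
  position 0.\<close>

lemma recognises_succ: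
  "recognises (\<lambda>a. prod_encode (1, prod_encode (of_bool (Q a), of_bool (P a)))) succ_op
    (\<lambda>s e. pfst s \<noteq> 0 \<and> pfst e \<noteq> 0 \<and> pfst (psnd s) = 0 \<and> psnd (psnd s) = pfst (psnd e) \<and>
      psnd (psnd e) = pfst (psnd e)) (prod_encode (2, prod_encode (2, 2)))
    (\<lambda>w. \<not> Q (w 0) \<and> (\<forall>t. Q (w (Suc t)) = P (w t)))"
proof (rule recognisesI, goal_cases)
  case (1 w i j)
  then show ?case by (simp only: seg_succ_op) (intro prod_encode_less, simp_all)
next
  case (2 s t u)
  show ?case by (auto simp: succ_op_def)
next
  case (3 w f s e)
  have mono: "f n < f (Suc n)" for n using 3(1) by (simp add: strict_mono_less)
  have 0: "0 < f 1" using mono[of 0] 3(2) by simp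
  have pos: "f n > 0" if "n \<ge> 1" for n
    using strict_mono_imp_increasing[OF 3(1), of n] that by simp
  have s_eq: "s = prod_encode (of_bool (\<forall>t. Suc t < f 1 \<longrightarrow> Q (w (Suc t)) = P (w t)),
       prod_encode (of_bool (Q (w 0)), of_bool (P (w (f 1 - 1)))))"
    using 3(3) seg_succ_op[OF 0, of "\<lambda>t. Q (w t)" "\<lambda>t. P (w t)"] by simp
  have s: "pfst s \<noteq> 0 \<longleftrightarrow> (\<forall>t. Suc t < f 1 \<longrightarrow> Q (w (Suc t)) = P (w t))"
    "pfst (psnd s) = of_bool (Q (w 0))" "psnd (psnd s) = of_bool (P (w (f 1 - 1)))"
    by (simp_all add: s_eq)
  have e_eq: "e = prod_encode (of_bool (\<forall>t. f n \<le> t \<and> Suc t < f (Suc n) \<longrightarrow> Q (w (Suc t)) = P (w t)),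
       prod_encode (of_bool (Q (w (f n))), of_bool (P (w (f (Suc n) - 1)))))" if "n \<ge> 1" for n
    using 3(4)[OF that] seg_succ_op[OF mono, of "\<lambda>t. Q (w t)" "\<lambda>t. P (w t)" n] by simp
  have e: "pfst e \<noteq> 0 \<longleftrightarrow> (\<forall>t. f n \<le> t \<and> Suc t < f (Suc n) \<longrightarrow> Q (w (Suc t)) = P (w t))"
    "pfst (psnd e) = of_bool (Q (w (f n)))" "psnd (psnd e) = of_bool (P (w (f (Suc n) - 1)))"
    if "n \<ge> 1" for n
    by (auto simp: e_eq[OF that])
  show ?case
  proof
    assume *: "\<not> Q (w 0) \<and> (\<forall>t. Q (w (Suc t)) = P (w t))"
    \<comment> \<open>\<open>f n - 1\<close> is the last position of the block before
      \<open>f n\<close>; positivity of \<open>f n\<close> makes the subtraction exact.\<close>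
    have link: "P (w (f n - 1)) = Q (w (f n))" if "n \<ge> 1" for n
    proof -
      have "Q (w (Suc (f n - 1))) = P (w (f n - 1))" using * by blast
      moreover have "Suc (f n - 1) = f n" using pos[OF that] by simp
      ultimately show ?thesis by (simp only:)
    qed
    have "psnd (psnd s) = pfst (psnd e)"
      using link[of 1] e(2)[of 1] s(3) by (simp only: le_refl)
    moreover have "psnd (psnd e) = pfst (psnd e)"
    proof -
      have "psnd (psnd e) = of_bool (P (w (f (Suc 1) - 1)))" by (rule e(3)) simp
      moreover have "pfst (psnd e) = of_bool (Q (w (f (Suc 1))))" by (rule e(2)) simp
      moreover have "P (w (f (Suc 1) - 1)) = Q (w (f (Suc 1)))" by (rule link) simp
      ultimately show ?thesis by (simp only:)
    qed
    ultimately show "pfst s \<noteq> 0 \<and> pfst e \<noteq> 0 \<and> pfst (psnd s) = 0 \<and> psnd (psnd s) = pfst (psnd e) \<and>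
      psnd (psnd e) = pfst (psnd e)"
      using * s(1) s(2) e(1)[OF order.refl] by auto
  next
    assume *: "pfst s \<noteq> 0 \<and> pfst e \<noteq> 0 \<and> pfst (psnd s) = 0 \<and> psnd (psnd s) = pfst (psnd e) \<and>
      psnd (psnd e) = pfst (psnd e)"
    have "Q (w (Suc t)) = P (w t)" for t
    proof -
      obtain n where n: "f n \<le> t" "t < f (Suc n)" using strict_mono_block 3(1,2) by blast
      show ?thesis
      proof (cases "Suc t < f (Suc n)")
        case True
        show ?thesis
        proof (cases "n = 0")
          case True
          then show ?thesis using * s(1) \<open>Suc t < f (Suc n)\<close> by simp
        next
          case False
          then show ?thesis using * e(1)[of n] n \<open>Suc t < f (Suc n)\<close> by simp
        qed
      next
        case False
        with n have t: "Suc t = f (Suc n)" "t = f (Suc n) - 1" by simp_all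
        have "of_bool (Q (w (f (Suc n)))) = (of_bool (P (w (f (Suc n) - 1))) :: nat)"
        proof (cases "n = 0")
          case True
          then show ?thesis using * s(3) e(2)[of 1] by simp
        next
          case False
          then show ?thesis using * e(3)[of n] e(2)[of "Suc n"] by simp
        qed
        then have "Q (w (f (Suc n))) = P (w (f (Suc n) - 1))"
          by (simp only: of_bool_eq_iff)
        then show ?thesis by (simp only: t(1) flip: t(2))
      qed
    qed
    moreover have "\<not> Q (w 0)" using * s(2) by simp
    ultimately show "\<not> Q (w 0) \<and> (\<forall>t. Q (w (Suc t)) = P (w t))" by blast
  qed
qed

section \<open>Existential quantification over a track\<close>

definition set_op :: "(nat \<Rightarrow> nat \<Rightarrow> nat) \<Rightarrow> nat \<Rightarrow> nat \<Rightarrow> nat" where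
  "set_op m S T = set_encode (case_prod m ` (set_decode S \<times> set_decode T))"

text \<open>\<open>s\<close> is sought in \<open>S E^(i+1)\<close> and \<open>e\<close> in
  \<open>E^(j+1)\<close>: the lifted word is factorised into the first block with
  \<open>i + 1\<close> further ones, followed by groups of \<open>j + 1\<close> blocks. Exponents
  below \<open>2 ^ b\<close> suffice because the powers of \<open>E\<close> that occur code subsets
  of \<open>{..<b}\<close>, of which there are \<open>2 ^ b\<close>.\<close>

definition set_acc :: "(nat \<Rightarrow> nat \<Rightarrow> nat) \<Rightarrow> (nat \<Rightarrow> nat \<Rightarrow> bool) \<Rightarrow> nat \<Rightarrow> nat \<Rightarrow> nat \<Rightarrow> bool" where
  "set_acc m ac b S E \<longleftrightarrow> (\<exists>i<2 ^ b. \<exists>j<2 ^ b. \<exists>s<b. \<exists>e<b.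
     s \<in> set_decode (set_op m S (op_power (set_op m) E i)) \<and>
     e \<in> set_decode (op_power (set_op m) E j) \<and> ac s e)"

lemma set_decode_set_op:
  "set_decode (set_op m S T) = case_prod m ` (set_decode S \<times> set_decode T)"
  unfolding set_op_def by (rule set_encode_inverse) simp

lemma set_op_assoc:
  assumes "\<And>s t u. m (m s t) u = m s (m t u)"
  shows "set_op m (set_op m S T) U = set_op m S (set_op m T U)"
proof -
  have "case_prod m ` ((case_prod m ` (A \<times> B)) \<times> C) = case_prod m ` (A \<times> (case_prod m ` (B \<times> C)))"
    for A B C
    by (force simp: image_iff assms)
  then have "set_decode (set_op m (set_op m S T) U) = set_decode (set_op m S (set_op m T U))"
    by (simp only: set_decode_set_op)
  then show ?thesis by (metis set_decode_inverse)
qed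

lemma set_encode_less: "A \<subseteq> {..<b} \<Longrightarrow> set_encode A < 2 ^ b"
proof -
  assume "A \<subseteq> {..<b}"
  then have "set_encode A \<le> (\<Sum>i<b. 2 ^ i)"
    unfolding set_encode_def by (intro sum_mono2) auto
  also have "\<dots> < 2 ^ b"
    by (induction b) auto
  finally show ?thesis .
qed

text \<open>The choices at different positions are independent, so a product of two-element sets
  collects the types of all labellings of the segment.\<close>

lemma in_set_decode_seg:
  assumes "i < j"
  shows "s \<in> set_decode (seg (set_op m) (\<lambda>t. set_encode {h (upd (w t) False), h (upd (w t) True)}) i j)
    \<longleftrightarrow> (\<exists>A. s = seg m (\<lambda>t. h (upd (w t) (A t))) i j)"
  using assms
proof (induction arbitrary: s rule: seg_induct)
  case single
  have "(\<exists>A :: nat \<Rightarrow> bool. s = h (upd (w i) (A i))) \<longleftrightarrow> (\<exists>v. s = h (upd (w i) v))"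
  proof
    assume "\<exists>v. s = h (upd (w i) v)"
    then obtain v where "s = h (upd (w i) v)" by blast
    then show "\<exists>A :: nat \<Rightarrow> bool. s = h (upd (w i) (A i))" by (rule exI[of _ "\<lambda>_. v"])
  qed blast
  then show ?case by (auto simp: ex_bool_eq)
next
  case (Suc j)
  show ?case (is "?L \<longleftrightarrow> ?R")
  proof
    assume ?L
    then obtain A v where s: "s = m (seg m (\<lambda>t. h (upd (w t) (A t))) i j) (h (upd (w j) v))"
      using Suc by (auto simp: seg_Suc set_decode_set_op)
    \<comment> \<open>Position \<open>j\<close> lies outside the segment from \<open>i\<close> to
      \<open>j\<close>, so the labelling may be redefined there to realise the last factor.\<close>
    have "seg m (\<lambda>t. h (upd (w t) (A t))) i j = seg m (\<lambda>t. h (upd (w t) ((A(j := v)) t))) i j"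
      using Suc(1) by (intro seg_cong) auto
    then have "s = seg m (\<lambda>t. h (upd (w t) ((A(j := v)) t))) i (Suc j)"
      using s Suc(1) by (simp add: seg_Suc)
    then show ?R by blast
  next
    assume ?R
    then obtain A where s: "s = seg m (\<lambda>t. h (upd (w t) (A t))) i (Suc j)" by blast
    have "seg m (\<lambda>t. h (upd (w t) (A t))) i j \<in>
        set_decode (seg (set_op m) (\<lambda>t. set_encode {h (upd (w t) False), h (upd (w t) True)}) i j)"
      using Suc(2) by blast
    moreover have "h (upd (w j) (A j)) \<in> {h (upd (w j) False), h (upd (w j) True)}"
      by (cases "A j") auto
    ultimately show ?L
      using s Suc(1) by (auto simp: seg_Suc set_decode_set_op image_iff)
  qed
qed

text \<open>A factorisation of the projected word into blocks of equal type lifts to one of a preimage only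
  after merging blocks, as provided by Ramsey's theorem.\<close>

lemma recognises_Ex:
  fixes upd :: "'l \<Rightarrow> bool \<Rightarrow> 'l"
  assumes R: "recognises h m ac b L"
  shows "recognises (\<lambda>a. set_encode {h (upd a False), h (upd a True)}) (set_op m) (set_acc m ac b) (2 ^ b)
    (\<lambda>w. \<exists>A. L (\<lambda>t. upd (w t) (A t)))"
proof (rule recognisesI, goal_cases)
  case (1 w i j)
  let ?S = "seg (set_op m) (\<lambda>t. set_encode {h (upd (w t) False), h (upd (w t) True)}) i j"
  have "set_decode ?S \<subseteq> {..<b}"
    using 1 recognises_less[OF R 1] by (auto simp: in_set_decode_seg)
  from set_encode_less[OF this] show ?case by simp
next
  case (2 s t u)
  show ?case by (rule set_op_assoc) (rule recognises_assoc[OF R])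
next
  case (3 w f S E)
  note assoc = set_op_assoc[of m, OF recognises_assoc[OF R]]
  define H where "H = (\<lambda>t. set_encode {h (upd (w t) False), h (upd (w t) True)})"
  have in_H: "s \<in> set_decode (seg (set_op m) H i j) \<longleftrightarrow> (\<exists>A. s = seg m (\<lambda>t. h (upd (w t) (A t))) i j)"
    if "i < j" for s i j
    using in_set_decode_seg[OF that] unfolding H_def .
  have mono: "f i < f j" if "i < j" for i j using 3(1) that by (simp add: strict_mono_less)
  have S: "seg (set_op m) H 0 (f 1) = S" and E: "\<And>n. n \<ge> 1 \<Longrightarrow> seg (set_op m) H (f n) (f (Suc n)) = E"
    using 3(3,4) by (simp_all add: H_def)
  have power: "seg (set_op m) H (f n) (f (Suc (n + k))) = op_power (set_op m) E k" if "n \<ge> 1" for n k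
    using seg_seg[of "set_op m" f n "Suc (n + k)" H, OF assoc 3(1)]
      seg_const[of n "\<lambda>n. seg (set_op m) H (f n) (f (Suc n))" E "set_op m" k] E that by simp
  \<comment> \<open>The prefix up to \<open>f (k + 2)\<close> consists of the first block and
    \<open>k + 1\<close> blocks of type \<open>E\<close>, in agreement with the shifted exponent of
    \<open>op_power\<close>.\<close>
  have prefix: "seg (set_op m) H 0 (f (Suc (Suc k))) = set_op m S (op_power (set_op m) E k)" for k
    using seg_append[of "set_op m" 0 "f 1" "f (Suc (Suc k))" H, OF assoc] mono[of 0 1] mono[of 1 "Suc (Suc k)"]
      S power[of 1 k] 3(2) by simp
  have E_less: "op_power (set_op m) E k < 2 ^ b" for k
  proof -
    have "set_decode (op_power (set_op m) E k) \<subseteq> {..<b}"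
      using in_H[OF mono, of 1 "Suc (1 + k)"] power[of 1 k] mono[of 1 "Suc (1 + k)"] recognises_less[OF R]
      by auto
    from set_encode_less[OF this] show ?thesis by simp
  qed
  have small: "\<exists>i<2 ^ b. op_power (set_op m) E k = op_power (set_op m) E i" for k
    using orbit_value_bounded[of "op_power (set_op m) E" "\<lambda>r. set_op m r E" "{..<2 ^ b}"] E_less by simp
  show ?case
  proof
    assume "\<exists>A. L (\<lambda>t. upd (w t) (A t))"
    then obtain A where A: "L (\<lambda>t. upd (w t) (A t))" by blast
    define g where "g = (\<lambda>t. h (upd (w t) (A t)))"
    have g_in: "seg m g i j \<in> set_decode (seg (set_op m) H i j)" if "i < j" for i j
      using in_H[OF that] unfolding g_def by blast
    have less: "seg m g i j < b" if "i < j" for i j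
      using recognises_less[OF R that] unfolding g_def .
    \<comment> \<open>The colouring for Ramsey's theorem: a pair of block borders is coloured by the
      type of the lifted word between them. Finitely many colours occur because types of lifted
      segments are below \<open>b\<close>.\<close>
    define F where "F X = seg m g (f (Min X)) (f (Max X))" for X
    have F: "F {x, y} = seg m g (f x) (f y)" if "x < y" for x y
      using that by (simp add: F_def min_def max_def)
    have "F {x, y} < b" if "x \<noteq> y" for x y
      using F[of x y] F[of y x] that less[OF mono] by (cases "x < y") (simp_all add: insert_commute)
    \<comment> \<open>Borders are taken from index 2 on, so that the part before the first chosen
      border contains at least one block of type \<open>E\<close>, as \<open>op_power\<close> has no
      zeroth power.\<close>
    then have part: "\<forall>x\<in>{2..}. \<forall>y\<in>{2..}. x \<noteq> y \<longrightarrow> F {x, y} < b" by blast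
    obtain Y e where Y: "Y \<subseteq> {2..}" "infinite Y"
      and Ye: "\<forall>x\<in>Y. \<forall>y\<in>Y. x \<noteq> y \<longrightarrow> F {x, y} = e"
      using Ramsey2[of "{2..}" F b, OF infinite_Ici part] by (elim exE conjE)
    have e: "seg m g (f x) (f y) = e" if "x \<in> Y" "y \<in> Y" "x < y" for x y
      using Ye that F[of x y] by auto
    define y where "y = enumerate Y"
    have y_mono: "y n < y (Suc n)" for n unfolding y_def using Y(2) by (rule enumerate_step)
    have y_in: "y n \<in> Y" for n unfolding y_def using Y(2) by (rule enumerate_in_set)
    \<comment> \<open>Merging the blocks between consecutive elements of the homogeneous set gives a
      factorisation of the lifted word in which all blocks after the first have the type
      \<open>e\<close>.\<close>
    define c where "c n = (case n of 0 \<Rightarrow> 0 | Suc k \<Rightarrow> f (y k))" for n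
    have y_ge: "y n \<ge> 2" for n using y_in Y(1) by auto
    have "0 < f (y 0)" using mono[of 0 "y 0"] 3(2) y_ge[of 0] by simp
    then have "c n < c (Suc n)" for n
      by (cases n) (simp_all add: c_def mono y_mono)
    then have c: "strict_mono c" by (simp add: strict_mono_Suc_iff)
    have ce: "seg m g (c n) (c (Suc n)) = e" if "n \<ge> 1" for n
    proof -
      obtain k where n: "n = Suc k" using \<open>n \<ge> 1\<close> by (cases n) auto
      show ?thesis
        using e[OF y_in y_in y_mono, of k] by (simp add: n c_def)
    qed
    have "ac (seg m g 0 (c 1)) e"
      using recognises_iff[OF R c _ _ ce[unfolded g_def], of "seg m g 0 (c 1)"] A
      by (simp add: c_def g_def)
    moreover have c1: "c 1 = f (Suc (Suc (y 0 - 2)))"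
    proof -
      have "Suc (Suc (y 0 - 2)) = y 0" using y_ge[of 0] by arith
      then show ?thesis by (simp add: c_def)
    qed
    have c_pos: "0 < c 1" using strict_monoD[OF c, of 0 1] by (simp add: c_def)
    have "seg m g 0 (c 1) \<in> set_decode (set_op m S (op_power (set_op m) E (y 0 - 2)))"
      using g_in[OF c_pos] prefix[of "y 0 - 2"] by (simp only: c1)
    moreover have "e \<in> set_decode (op_power (set_op m) E (y 1 - y 0 - 1))"
    proof -
      have "Suc (y 0 + (y 1 - y 0 - 1)) = y 1" using y_mono[of 0] by simp
      moreover have "e \<in> set_decode (seg (set_op m) H (f (y 0)) (f (y 1)))"
        using g_in[of "c 1" "c 2"] ce[of 1] strict_monoD[OF c, of 1 2]
        by (simp add: c_def numeral_2_eq_2)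
      ultimately show ?thesis using power[of "y 0" "y 1 - y 0 - 1"] y_ge[of 0] by simp
    qed
    moreover have "seg m g 0 (c 1) < b" using less[OF c_pos] .
    moreover have "e < b" using ce[of 1] less[of "c 1" "c 2"] strict_monoD[OF c, of 1 2]
      by (simp add: numeral_2_eq_2)
    ultimately show "set_acc m ac b S E"
      unfolding set_acc_def using small[of "y 0 - 2"] small[of "y 1 - y 0 - 1"] by metis
  next
    assume "set_acc m ac b S E"
    then obtain i j s e where ac: "ac s e"
      and s: "s \<in> set_decode (set_op m S (op_power (set_op m) E i))"
      and e: "e \<in> set_decode (op_power (set_op m) E j)"
      unfolding set_acc_def by blast
    \<comment> \<open>The first merged block ends at \<open>f (i + 2)\<close> and has type
      \<open>S E^(i+1)\<close>; each later one comprises \<open>j + 1\<close> original blocks and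
      has type \<open>E^(j+1)\<close>.\<close>
    define c where "c n = (case n of 0 \<Rightarrow> 0 | Suc k \<Rightarrow> f (Suc (Suc i) + k * Suc j))" for n
    have "c n < c (Suc n)" for n
      using mono[of 0 "Suc (Suc i)"] 3(2) by (cases n) (auto simp: c_def intro!: mono)
    then have c: "strict_mono c" by (simp add: strict_mono_Suc_iff)
    have "\<exists>A. (if n = 0 then s else e) = seg m (\<lambda>t. h (upd (w t) (A t))) (c n) (c (Suc n))" for n
    proof (cases n)
      case 0
      have "s \<in> set_decode (seg (set_op m) H (c 0) (c (Suc 0)))"
        using s prefix[of i] by (simp add: c_def)
      with in_H[OF strict_monoD[OF c, of 0 "Suc 0"]] show ?thesis using 0 by simp
    next
      case (Suc k)
      have "e \<in> set_decode (seg (set_op m) H (c n) (c (Suc n)))"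
        using e power[of "Suc (Suc i) + k * Suc j" j] by (simp add: c_def Suc ac_simps)
      with in_H[OF strict_monoD[OF c, of n "Suc n"]] show ?thesis using Suc by simp
    qed
    then obtain A where
      A: "\<And>n. seg m (\<lambda>t. h (upd (w t) (A n t))) (c n) (c (Suc n)) = (if n = 0 then s else e)"
      by metis
    \<comment> \<open>Each block has its own labelling \<open>A n\<close>. They are glued by using
      at time \<open>t\<close> the labelling of the block containing \<open>t\<close>, whose index
      the \<open>LEAST\<close> expression returns.\<close>
    define B where "B t = A (LEAST n. t < c (Suc n)) t" for t
    have "B t = A n t" if "c n \<le> t" "t < c (Suc n)" for n t
    proof -
      have "(LEAST n. t < c (Suc n)) = n"
      proof (rule Least_equality)
        fix k assume "t < c (Suc k)"
        then have "c n < c (Suc k)" using that by simp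
        then show "n \<le> k" using c by (simp add: strict_mono_less)
      qed (use that in simp)
      then show ?thesis by (simp add: B_def)
    qed
    then have B: "seg m (\<lambda>t. h (upd (w t) (B t))) (c n) (c (Suc n)) = (if n = 0 then s else e)" for n
      using A[of n] seg_cong[of "c n" "c (Suc n)" "\<lambda>t. h (upd (w t) (B t))" "\<lambda>t. h (upd (w t) (A n t))" m]
        strict_monoD[OF c, of n "Suc n"] by simp
    have "L (\<lambda>t. upd (w t) (B t)) \<longleftrightarrow> ac s e"
    proof (rule recognises_iff[OF R c])
      show "c 0 = 0" by (simp add: c_def)
      then show "seg m (\<lambda>t. h (upd (w t) (B t))) 0 (c 1) = s" using B[of 0] by simp
    qed (use B in simp)
    with ac show "\<exists>A. L (\<lambda>t. upd (w t) (A t))" by blast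
  qed
qed

section \<open>Recognisers for monadic second-order formulas\<close>

text \<open>A letter consists of the first-order and the set variables that hold at a position; a
  first-order variable is identified with the singleton set of its value.\<close>

type_synonym letter = "(nat \<Rightarrow> bool) \<times> (nat \<Rightarrow> bool)"

definition set1 :: "nat \<Rightarrow> letter \<Rightarrow> bool \<Rightarrow> letter" where
  "set1 x a v = ((fst a)(x := v), snd a)"

definition set2 :: "nat \<Rightarrow> letter \<Rightarrow> bool \<Rightarrow> letter" where
  "set2 X a v = (fst a, (snd a)(X := v))"

text \<open>The atoms are restated as conditions on whole tracks: equality of tracks, a shift, an
  inclusion. They have the intended meaning when first-order tracks are singletons, which holds for
  words built from an assignment and is demanded again by the \<open>Ex1\<close> clause.\<close>

primrec word_sat :: "mso \<Rightarrow> (nat \<Rightarrow> letter) \<Rightarrow> bool" where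
  "word_sat (Eq x y) w \<longleftrightarrow> (\<forall>t. fst (w t) x = fst (w t) y)"
| "word_sat (Succ x y) w \<longleftrightarrow> \<not> fst (w 0) y \<and> (\<forall>t. fst (w (Suc t)) y = fst (w t) x)"
| "word_sat (Mem x X) w \<longleftrightarrow> (\<forall>t. fst (w t) x \<longrightarrow> snd (w t) X)"
| "word_sat (Neg \<phi>) w \<longleftrightarrow> \<not> word_sat \<phi> w"
| "word_sat (Conj \<phi> \<psi>) w \<longleftrightarrow> word_sat \<phi> w \<and> word_sat \<psi> w"
| "word_sat (Ex1 x \<phi>) w \<longleftrightarrow> (\<exists>A. (\<exists>!t. A t) \<and> word_sat \<phi> (\<lambda>t. set1 x (w t) (A t)))"
| "word_sat (Ex2 X \<phi>) w \<longleftrightarrow> (\<exists>A. word_sat \<phi> (\<lambda>t. set2 X (w t) (A t)))"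

text \<open>Choosing a value for \<open>x\<close> amounts to replacing its track by the indicator of
  a singleton, so both quantifiers become the choice of a new track.\<close>

lemma sat_iff_word_sat: "sat e S \<phi> \<longleftrightarrow> word_sat \<phi> (\<lambda>t. (\<lambda>x. e x = t, \<lambda>X. t \<in> S X))"
proof (induction \<phi> arbitrary: e S)
  case (Succ x y)
  show ?case
  proof
    assume "sat e S (Succ x y)"
    then show "word_sat (Succ x y) (\<lambda>t. (\<lambda>x. e x = t, \<lambda>X. t \<in> S X))" by auto
  next
    assume "word_sat (Succ x y) (\<lambda>t. (\<lambda>x. e x = t, \<lambda>X. t \<in> S X))"
    then have "e y = Suc t \<longleftrightarrow> e x = t" for t by simp
    then show "sat e S (Succ x y)" by simp
  qed
next
  case (Ex1 x \<phi>)
  have upd: "(\<lambda>t. set1 x (\<lambda>x. e x = t, \<lambda>X. t \<in> S X) (u = t)) = (\<lambda>t. (\<lambda>y. (e(x := u)) y = t, \<lambda>X. t \<in> S X))"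
    for u by (auto simp: set1_def fun_eq_iff)
  show ?case
  proof
    assume "sat e S (Ex1 x \<phi>)"
    then obtain u where "sat (e(x := u)) S \<phi>" by auto
    then have "word_sat \<phi> (\<lambda>t. set1 x (\<lambda>x. e x = t, \<lambda>X. t \<in> S X) (u = t))"
      by (simp only: Ex1 upd)
    moreover have "\<exists>!t. u = t" by simp
    ultimately show "word_sat (Ex1 x \<phi>) (\<lambda>t. (\<lambda>x. e x = t, \<lambda>X. t \<in> S X))"
      unfolding word_sat.simps by (intro exI[of _ "\<lambda>t. u = t"] conjI)
  next
    assume "word_sat (Ex1 x \<phi>) (\<lambda>t. (\<lambda>x. e x = t, \<lambda>X. t \<in> S X))"
    then obtain A where A: "\<exists>!t. A t" "word_sat \<phi> (\<lambda>t. set1 x (\<lambda>x. e x = t, \<lambda>X. t \<in> S X) (A t))"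
      unfolding word_sat.simps by (elim exE conjE)
    define u where "u = (THE t. A t)"
    have "A u" unfolding u_def using A(1) by (rule theI')
    moreover have "u = t" if "A t" for t
      unfolding u_def using A(1) that by (rule the1_equality)
    ultimately have A_eq: "A = (\<lambda>t. u = t)" by metis
    have "word_sat \<phi> (\<lambda>t. set1 x (\<lambda>x. e x = t, \<lambda>X. t \<in> S X) (u = t))"
      by (rule subst[OF A_eq, where P = "\<lambda>A. word_sat \<phi> (\<lambda>t. set1 x (\<lambda>x. e x = t, \<lambda>X. t \<in> S X) (A t))"])
        (rule A(2))
    then have "sat (e(x := u)) S \<phi>"
      by (simp only: Ex1 upd)
    then show "sat e S (Ex1 x \<phi>)" by auto
  qed
next
  case (Ex2 X \<phi>)
  have upd: "(\<lambda>t. set2 X (\<lambda>x. e x = t, \<lambda>X. t \<in> S X) (A t))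
      = (\<lambda>t. (\<lambda>y. e y = t, \<lambda>Y. t \<in> (S(X := {t. A t})) Y))"
    for A by (auto simp: set2_def fun_eq_iff)
  show ?case
  proof
    assume "sat e S (Ex2 X \<phi>)"
    then obtain A where "sat e (S(X := {t. t \<in> A})) \<phi>" by auto
    then have "word_sat \<phi> (\<lambda>t. set2 X (\<lambda>x. e x = t, \<lambda>X. t \<in> S X) (t \<in> A))"
      by (simp only: Ex2 upd)
    then show "word_sat (Ex2 X \<phi>) (\<lambda>t. (\<lambda>x. e x = t, \<lambda>X. t \<in> S X))"
      unfolding word_sat.simps by (rule exI[of _ "\<lambda>t. t \<in> A"])
  next
    assume "word_sat (Ex2 X \<phi>) (\<lambda>t. (\<lambda>x. e x = t, \<lambda>X. t \<in> S X))"
    then obtain A where "word_sat \<phi> (\<lambda>t. set2 X (\<lambda>x. e x = t, \<lambda>X. t \<in> S X) (A t))"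
      unfolding word_sat.simps by (elim exE)
    then have "sat e (S(X := {t. A t})) \<phi>"
      by (simp only: Ex2 upd)
    then show "sat e S (Ex2 X \<phi>)" by auto
  qed
qed auto

text \<open>\<open>Ex1\<close> is handled as projection of the conjunction of "the track of
  \<open>x\<close> has exactly one element" with the body. Hence its letters are sets of pairs,
  whose first component 0 or 1 is the contribution of the position to the count.\<close>

primrec letter_type :: "mso \<Rightarrow> letter \<Rightarrow> nat" where
  "letter_type (Eq x y) a = of_bool (fst a x = fst a y)"
| "letter_type (Succ x y) a = prod_encode (1, prod_encode (of_bool (fst a y), of_bool (fst a x)))"
| "letter_type (Mem x X) a = of_bool (fst a x \<longrightarrow> snd a X)"
| "letter_type (Neg \<phi>) a = letter_type \<phi> a"
| "letter_type (Conj \<phi> \<psi>) a = prod_encode (letter_type \<phi> a, letter_type \<psi> a)"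
| "letter_type (Ex1 x \<phi>) a =
     set_encode {prod_encode (0, letter_type \<phi> (set1 x a False)), prod_encode (1, letter_type \<phi> (set1 x a True))}"
| "letter_type (Ex2 X \<phi>) a =
     set_encode {letter_type \<phi> (set2 X a False), letter_type \<phi> (set2 X a True)}"

primrec type_op :: "mso \<Rightarrow> nat \<Rightarrow> nat \<Rightarrow> nat" where
  "type_op (Eq x y) = and_op"
| "type_op (Succ x y) = succ_op"
| "type_op (Mem x X) = and_op"
| "type_op (Neg \<phi>) = type_op \<phi>"
| "type_op (Conj \<phi> \<psi>) = pair_op (type_op \<phi>) (type_op \<psi>)"
| "type_op (Ex1 x \<phi>) = set_op (pair_op count_op (type_op \<phi>))"
| "type_op (Ex2 X \<phi>) = set_op (type_op \<phi>)"

primrec type_bound :: "mso \<Rightarrow> nat" where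
  "type_bound (Eq x y) = 2"
| "type_bound (Succ x y) = prod_encode (2, prod_encode (2, 2))"
| "type_bound (Mem x X) = 2"
| "type_bound (Neg \<phi>) = type_bound \<phi>"
| "type_bound (Conj \<phi> \<psi>) = prod_encode (type_bound \<phi>, type_bound \<psi>)"
| "type_bound (Ex1 x \<phi>) = 2 ^ prod_encode (3, type_bound \<phi>)"
| "type_bound (Ex2 X \<phi>) = 2 ^ type_bound \<phi>"

primrec type_acc :: "mso \<Rightarrow> nat \<Rightarrow> nat \<Rightarrow> bool" where
  "type_acc (Eq x y) s e \<longleftrightarrow> s \<noteq> 0 \<and> e \<noteq> 0"
| "type_acc (Succ x y) s e \<longleftrightarrow> pfst s \<noteq> 0 \<and> pfst e \<noteq> 0 \<and> pfst (psnd s) = 0 \<and>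
     psnd (psnd s) = pfst (psnd e) \<and> psnd (psnd e) = pfst (psnd e)"
| "type_acc (Mem x X) s e \<longleftrightarrow> s \<noteq> 0 \<and> e \<noteq> 0"
| "type_acc (Neg \<phi>) s e \<longleftrightarrow> \<not> type_acc \<phi> s e"
| "type_acc (Conj \<phi> \<psi>) s e \<longleftrightarrow> type_acc \<phi> (pfst s) (pfst e) \<and> type_acc \<psi> (psnd s) (psnd e)"
| "type_acc (Ex1 x \<phi>) s e \<longleftrightarrow> set_acc (pair_op count_op (type_op \<phi>))
     (\<lambda>s e. (pfst s = 1 \<and> pfst e = 0) \<and> type_acc \<phi> (psnd s) (psnd e)) (prod_encode (3, type_bound \<phi>)) s e"
| "type_acc (Ex2 X \<phi>) s e \<longleftrightarrow> set_acc (type_op \<phi>) (type_acc \<phi>) (type_bound \<phi>) s e"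

lemma recognises_mso:
  "recognises (letter_type \<phi>) (type_op \<phi>) (type_acc \<phi>) (type_bound \<phi>) (word_sat \<phi>)"
proof (induction \<phi>)
  case (Eq x y)
  show ?case using recognises_all[of "\<lambda>a :: letter. fst a x = fst a y"]
    by (simp add: fun_eq_iff[symmetric] letter_type.simps[abs_def] type_acc.simps[abs_def] word_sat.simps[abs_def])
next
  case (Succ x y)
  show ?case using recognises_succ[of "\<lambda>a :: letter. fst a y" "\<lambda>a. fst a x"]
    by (simp add: letter_type.simps[abs_def] type_acc.simps[abs_def] word_sat.simps[abs_def])
next
  case (Mem x X)
  show ?case using recognises_all[of "\<lambda>a :: letter. fst a x \<longrightarrow> snd a X"]
    by (simp add: letter_type.simps[abs_def] type_acc.simps[abs_def] word_sat.simps[abs_def])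
next
  case (Neg \<phi>)
  then show ?case using recognises_Neg[OF Neg]
    by (simp add: letter_type.simps[abs_def] type_acc.simps[abs_def] word_sat.simps[abs_def])
next
  case (Conj \<phi> \<psi>)
  then show ?case using recognises_Conj[OF Conj]
    by (simp add: letter_type.simps[abs_def] type_acc.simps[abs_def] word_sat.simps[abs_def])
next
  case (Ex1 x \<phi>)
  \<comment> \<open>The track of \<open>x\<close> in the updated word is the chosen
    \<open>A\<close>, so uniqueness on that track is the condition \<open>\<exists>!t. A t\<close>
    in \<open>word_sat\<close>.\<close>
  have "fst (set1 x a v) x = v" for a v by (simp add: set1_def)
  then show ?case
    using recognises_Ex[OF recognises_Conj[OF recognises_ex1[of "\<lambda>a. fst a x"] Ex1], of "set1 x"]
    by (simp add: letter_type.simps[abs_def] type_acc.simps[abs_def] word_sat.simps[abs_def])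
next
  case (Ex2 X \<phi>)
  show ?case using recognises_Ex[OF Ex2, of "set2 X"]
    by (simp add: letter_type.simps[abs_def] type_acc.simps[abs_def] word_sat.simps[abs_def])
qed

text \<open>This allows the letters of a trajectory, which carry a dummy first-order part and
  infinitely many set variables, to be replaced by finite data given by numerals.\<close>

lemma letter_type_cong:
  "(\<And>x. x \<in> free1 \<phi> \<Longrightarrow> fst a x = fst a' x) \<Longrightarrow> (\<And>X. X \<in> free2 \<phi> \<Longrightarrow> snd a X = snd a' X) \<Longrightarrow>
    letter_type \<phi> a = letter_type \<phi> a'"
proof (induction \<phi> arbitrary: a a')
  case (Neg \<phi>)
  show ?case using Neg.IH[of a a'] Neg.prems by simp
next
  case (Conj \<phi> \<psi>)
  have "letter_type \<phi> a = letter_type \<phi> a'"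
    by (rule Conj.IH(1)) (simp_all add: Conj.prems)
  moreover have "letter_type \<psi> a = letter_type \<psi> a'"
    by (rule Conj.IH(2)) (simp_all add: Conj.prems)
  ultimately show ?case by simp
next
  case (Ex1 x \<phi>)
  then have "letter_type \<phi> (set1 x a v) = letter_type \<phi> (set1 x a' v)" for v
    by (intro Ex1.IH) (auto simp: set1_def)
  then show ?case by simp
next
  case (Ex2 X \<phi>)
  then have "letter_type \<phi> (set2 X a v) = letter_type \<phi> (set2 X a' v)" for v
    by (intro Ex2.IH) (auto simp: set2_def)
  then show ?case by simp
qed auto

section \<open>Computability of the recognisers\<close>

lemma decid_iff: "decid P \<Longrightarrow> decid Q \<Longrightarrow> decid (\<lambda>x. P x \<longleftrightarrow> Q x)"
  unfolding iff_conv_conj_imp by (intro decid_conj decid_imp)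

text \<open>In both codings tag 0 belongs to a constructor without subterms. All other tags are
  positive, so subterms have smaller codes, as the guard \<open>d < c\<close> of the nested
  recursion demands.\<close>

lemma less_prod_encode [simp]: "0 < a \<Longrightarrow> b < prod_encode (a, b)"
  using psnd_less[of "prod_encode (a, b)"] by simp

lemma less_prod_encode_prod_encode [simp]:
  "0 < a \<Longrightarrow> b < prod_encode (a, prod_encode (b, c))"
  "0 < a \<Longrightarrow> c < prod_encode (a, prod_encode (b, c))"
  by (meson le_less_trans le_prod_encode_1 le_prod_encode_2 less_prod_encode)+

section \<open>Updating sets given by binary numerals\<close>

definition adjoin :: "nat \<Rightarrow> nat \<Rightarrow> nat" where
  "adjoin i A = (if i \<in> set_decode A then A else A + 2 ^ i)"

definition remove :: "nat \<Rightarrow> nat \<Rightarrow> nat" where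
  "remove i A = (if i \<in> set_decode A then A - 2 ^ i else A)"

lemma set_decode_adjoin [simp]: "set_decode (adjoin i A) = insert i (set_decode A)"
proof -
  have "adjoin i A = set_encode (insert i (set_decode A))"
    by (simp add: adjoin_def insert_absorb)
  then show ?thesis by simp
qed

lemma set_decode_remove [simp]: "set_decode (remove i A) = set_decode A - {i}"
proof -
  have "A = 2 ^ i + set_encode (set_decode A - {i})" if "i \<in> set_decode A"
    using set_encode_insert[of "set_decode A - {i}" i] that by (simp add: insert_absorb)
  then have "remove i A = set_encode (set_decode A - {i})"
    by (auto simp: remove_def)
  then show ?thesis by simp
qed

text \<open>\<open>c\<close> will be the code of the formula, which is at least every variable bound
  at its head; the growth of the numeral under a quantifier is thus bounded by a computable function
  of the arguments.\<close>

lemma adjoin_le: "i \<le> c \<Longrightarrow> A \<le> z \<Longrightarrow> adjoin i A \<le> z + 2 ^ c"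
  unfolding adjoin_def by (simp add: add_mono power_increasing trans_le_add1)

lemma remove_le: "A \<le> z \<Longrightarrow> remove i A \<le> z + 2 ^ c"
  unfolding remove_def by auto

lemma computable_adjoin: "computable f \<Longrightarrow> computable g \<Longrightarrow> computable (\<lambda>x. adjoin (f x) (g x))"
  unfolding adjoin_def by (intro computable_intros)

lemma computable_remove: "computable f \<Longrightarrow> computable g \<Longrightarrow> computable (\<lambda>x. remove (f x) (g x))"
  unfolding remove_def by (intro computable_intros)

lemmas computable_table_intros = computable_intros computable_table_lookup computable_adjoin
  computable_remove decid_iff

section \<open>Types and acceptance computed from the code of a formula\<close>

lemma computable_type_bound:
  "\<exists>F. computable F \<and> (\<forall>\<phi>. F (code_mso \<phi>) = type_bound \<phi>)"
proof -
  define H where "H c x g =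
    (if pfst c = 0 \<or> pfst c = 2 then 2
     else if pfst c = 1 then prod_encode (2, prod_encode (2, 2))
     else if pfst c = 3 then g (psnd c) 0
     else if pfst c = 4 then prod_encode (g (pfst (psnd c)) 0, g (psnd (psnd c)) 0)
     else if pfst c = 5 then 2 ^ prod_encode (3, g (psnd (psnd c)) 0)
     else 2 ^ g (psnd (psnd c)) 0)" for c x :: nat and g :: "nat \<Rightarrow> nat \<Rightarrow> nat"
  have H: "computable (\<lambda>p. H (pfst p) (pfst (psnd p)) (table_lookup (psnd (psnd p))))"
    unfolding H_def by (intro computable_table_intros)
  obtain F where F: "computable2 F"
    and F_eq: "\<forall>c x. F c x = H c x (\<lambda>d y. if d < c \<and> y \<le> 0 then F d y else 0)"
    using computable_nested_recursion[of H "\<lambda>_ _. 0", OF H computable_const] by (elim exE conjE)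
  have "F (code_mso \<phi>) 0 = type_bound \<phi>" for \<phi>
    by (induction \<phi>) (subst F_eq[rule_format], simp add: H_def)+
  moreover have "computable (\<lambda>c. F c 0)"
    by (intro computable2_app[OF F] computable_arith)
  ultimately show ?thesis by blast
qed

text \<open>A version of \<open>set_op\<close> with bounded searches only: elements of a coded set
  are below its code, and the double sum is at least each single product, so it bounds the search
  for \<open>u\<close>.\<close>

definition set_op_code :: "(nat \<Rightarrow> nat \<Rightarrow> nat) \<Rightarrow> nat \<Rightarrow> nat \<Rightarrow> nat" where
  "set_op_code m S T = set_encode {u. u < Suc (\<Sum>p<S. \<Sum>q<T. m p q) \<and>
     (\<exists>p<S. \<exists>q<T. p \<in> set_decode S \<and> q \<in> set_decode T \<and> u = m p q)}"

text \<open>Agreement below \<open>S\<close> and \<open>T\<close> is what a recursive call can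
  offer, because the nested recursion returns 0 beyond its bound on arguments.\<close>

lemma set_op_code_eq:
  assumes "\<And>p q. p < S \<Longrightarrow> q < T \<Longrightarrow> m p q = m' p q"
  shows "set_op_code m S T = set_op m' S T"
proof -
  have "m p q \<le> (\<Sum>p<S. \<Sum>q<T. m p q)" if "p < S" "q < T" for p q
  proof -
    have "m p q \<le> (\<Sum>q<T. m p q)"
      using that by (intro member_le_sum[of q "{..<T}" "m p"]) auto
    also have "\<dots> \<le> (\<Sum>p<S. \<Sum>q<T. m p q)"
      using that by (intro member_le_sum[of p "{..<S}" "\<lambda>p. \<Sum>q<T. m p q"]) auto
    finally show ?thesis .
  qed
  then have "{u. u < Suc (\<Sum>p<S. \<Sum>q<T. m p q) \<and>
     (\<exists>p<S. \<exists>q<T. p \<in> set_decode S \<and> q \<in> set_decode T \<and> u = m p q)}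
     = {u. \<exists>p\<in>set_decode S. \<exists>q\<in>set_decode T. u = m p q}"
    by (auto simp: less_Suc_eq_le dest: in_set_decode_less intro: in_set_decode_less) 
  also have "\<dots> = case_prod m' ` (set_decode S \<times> set_decode T)"
    using assms in_set_decode_less by (auto simp: image_iff) 
  finally show ?thesis by (simp add: set_op_code_def set_op_def)
qed

lemma computable_set_op_code:
  assumes "computable (\<lambda>p. m (pfst p) (pfst (psnd p)) (psnd (psnd p)))" "computable S" "computable T"
  shows "computable (\<lambda>x. set_op_code (m x) (S x) (T x))"
proof -
  have m: "computable (\<lambda>x. m (f x) (g x) (h x))" if "computable f" "computable g" "computable h" for f g h
    using computable_comp[OF assms(1), of "\<lambda>x. prod_encode (f x, prod_encode (g x, h x))"] that
    by (simp add: computable_prod_encode)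
  have S: "computable (\<lambda>x. S (f x))" and T: "computable (\<lambda>x. T (f x))" if "computable f" for f
    using assms(2,3) that by (auto intro: computable_comp)
  have "computable (\<lambda>p. set_op_code (m (pfst p)) (pfst (psnd p)) (psnd (psnd p)))"
    unfolding set_op_code_def by (intro computable_intros m)
  from computable_comp[OF this, of "\<lambda>x. prod_encode (x, prod_encode (S x, T x))"] assms(2,3)
  show ?thesis by (simp add: computable_prod_encode computable_id)
qed

lemma computable_type_op:
  "\<exists>F. computable2 F \<and> (\<forall>\<phi> s t. F (code_mso \<phi>) (prod_encode (s, t)) = type_op \<phi> s t)"
proof -
  define H where "H c z g =
    (if pfst c = 0 \<or> pfst c = 2 then and_op (pfst z) (psnd z)
     else if pfst c = 1 then succ_op (pfst z) (psnd z)
     else if pfst c = 3 then g (psnd c) z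
     else if pfst c = 4 then pair_op (\<lambda>s t. g (pfst (psnd c)) (prod_encode (s, t)))
       (\<lambda>s t. g (psnd (psnd c)) (prod_encode (s, t))) (pfst z) (psnd z)
     else if pfst c = 5 then
       set_op_code (pair_op count_op (\<lambda>s t. g (psnd (psnd c)) (prod_encode (s, t)))) (pfst z) (psnd z)
     else set_op_code (\<lambda>s t. g (psnd (psnd c)) (prod_encode (s, t))) (pfst z) (psnd z))"
    for c z :: nat and g :: "nat \<Rightarrow> nat \<Rightarrow> nat"
  have min: "computable (\<lambda>x. min (f x) (g x))" if "computable f" "computable g" for f g
    unfolding min_def using that by (intro computable_intros)
  have H: "computable (\<lambda>p. H (pfst p) (pfst (psnd p)) (table_lookup (psnd (psnd p))))"
    unfolding H_def pair_op_def and_op_def succ_op_def count_op_def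
    by (intro computable_table_intros computable_set_op_code min)
  \<comment> \<open>Recursive calls go to pairs of components of \<open>z\<close>, or to pairs of
    elements of the sets coded by those components. None of these codes exceeds \<open>z\<close>, so
    \<open>z\<close> itself is an admissible bound.\<close>
  have B: "computable (\<lambda>p. psnd p)" by (intro computable_arith)
  obtain F where F: "computable2 F"
    and F_eq: "\<forall>c x. F c x = H c x (\<lambda>d y. if d < c \<and> y \<le> x then F d y else 0)"
    using computable_nested_recursion[of H "\<lambda>_ z. z", OF H B] by (elim exE conjE)
  have le: "prod_encode (pfst s, pfst t) \<le> prod_encode (s, t)"
    "prod_encode (psnd s, psnd t) \<le> prod_encode (s, t)" for s t
    by (simp_all add: prod_encode_mono pfst_le psnd_le)
  have le': "prod_encode (p, q) \<le> prod_encode (S, T)"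
    "prod_encode (psnd p, psnd q) \<le> prod_encode (S, T)" if "p < S" "q < T" for p q S T
    using that psnd_le[of p] psnd_le[of q] by (auto intro: prod_encode_mono)
  have "F (code_mso \<phi>) (prod_encode (s, t)) = type_op \<phi> s t" for \<phi> s t
  proof (induction \<phi> arbitrary: s t)
    case (Conj \<phi> \<psi>)
    then show ?case by (subst F_eq[rule_format]) (simp add: H_def pair_op_def le)
  next
    case (Ex1 x \<phi>)
    then show ?case
      by (subst F_eq[rule_format]) (simp add: H_def, intro set_op_code_eq, simp add: pair_op_def le')
  next
    case (Ex2 X \<phi>)
    then show ?case
      by (subst F_eq[rule_format]) (simp add: H_def, intro set_op_code_eq, simp add: le')
  qed (subst F_eq[rule_format], simp add: H_def)+
  with F show ?thesis by blast
qed

lemma set_encode_pair: "set_encode {a, b} = (if a = b then 2 ^ a else 2 ^ a + 2 ^ b)"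
  by (simp add: set_encode_def)

lemma le_letter_bound: "z \<le> prod_encode (z + k, z + k)" for z k :: nat
  by (rule order_trans[OF _ le_prod_encode_1]) simp

lemma letter_le_bound:
  assumes "A' \<le> A + k" "B' \<le> B + k"
  shows "prod_encode (A', B') \<le> prod_encode (prod_encode (A, B) + k, prod_encode (A, B) + k)"
  by (rule prod_encode_mono)
    (use assms le_prod_encode_1[of A B] le_prod_encode_2[of B A] in linarith)+

lemma variable_le_code: "x \<le> prod_encode (k, prod_encode (x, y))"
  using le_prod_encode_1[of x y] le_prod_encode_2[of "prod_encode (x, y)" k] by linarith

lemma computable_letter_type:
  "\<exists>F. computable2 F \<and> (\<forall>\<phi> A B. F (code_mso \<phi>) (prod_encode (A, B)) =
     letter_type \<phi> (\<lambda>x. x \<in> set_decode A, \<lambda>X. X \<in> set_decode B))"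
proof -
  define H where "H c z g =
    (if pfst c = 0 then of_bool (pfst (psnd c) \<in> set_decode (pfst z) \<longleftrightarrow> psnd (psnd c) \<in> set_decode (pfst z))
     else if pfst c = 1 then prod_encode (1, prod_encode
       (of_bool (psnd (psnd c) \<in> set_decode (pfst z)), of_bool (pfst (psnd c) \<in> set_decode (pfst z))))
     else if pfst c = 2 then of_bool (pfst (psnd c) \<in> set_decode (pfst z) \<longrightarrow> psnd (psnd c) \<in> set_decode (psnd z))
     else if pfst c = 3 then g (psnd c) z
     else if pfst c = 4 then prod_encode (g (pfst (psnd c)) z, g (psnd (psnd c)) z)
     else if pfst c = 5 then set_encode
       {prod_encode (0, g (psnd (psnd c)) (prod_encode (remove (pfst (psnd c)) (pfst z), psnd z))),
        prod_encode (1, g (psnd (psnd c)) (prod_encode (adjoin (pfst (psnd c)) (pfst z), psnd z)))}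
     else set_encode
       {g (psnd (psnd c)) (prod_encode (pfst z, remove (pfst (psnd c)) (psnd z))),
        g (psnd (psnd c)) (prod_encode (pfst z, adjoin (pfst (psnd c)) (psnd z)))})"
    for c z :: nat and g :: "nat \<Rightarrow> nat \<Rightarrow> nat"
  have H: "computable (\<lambda>p. H (pfst p) (pfst (psnd p)) (table_lookup (psnd (psnd p))))"
    unfolding H_def set_encode_pair by (intro computable_table_intros)
  \<comment> \<open>Here the second argument may grow: adjoining a variable \<open>x \<le> c\<close>
    adds at most \<open>2 ^ c\<close> to one of the two numerals, and both numerals are at most
    \<open>z\<close>.\<close>
  have B: "computable (\<lambda>p. prod_encode (psnd p + 2 ^ pfst p, psnd p + 2 ^ pfst p))"
    by (intro computable_intros)
  obtain F where F: "computable2 F"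
    and F_eq: "\<forall>c z. F c z = H c z
      (\<lambda>d y. if d < c \<and> y \<le> prod_encode (z + 2 ^ c, z + 2 ^ c) then F d y else 0)"
    using computable_nested_recursion[of H "\<lambda>c z. prod_encode (z + 2 ^ c, z + 2 ^ c)", OF H B] by (elim exE conjE)
  have set1: "set1 x (\<lambda>x. x \<in> set_decode A, P) v =
      (\<lambda>y. y \<in> set_decode (if v then adjoin x A else remove x A), P)" for x A P v
    by (auto simp: set1_def fun_eq_iff)
  have set2: "set2 x (P, \<lambda>x. x \<in> set_decode A) v =
      (P, \<lambda>y. y \<in> set_decode (if v then adjoin x A else remove x A))" for x A P v
    by (auto simp: set2_def fun_eq_iff)
  have "F (code_mso \<phi>) (prod_encode (A, B)) =
     letter_type \<phi> (\<lambda>x. x \<in> set_decode A, \<lambda>X. X \<in> set_decode B)" for \<phi> A B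
  proof (induction \<phi> arbitrary: A B)
    case (Neg \<phi>)
    then show ?case by (subst F_eq[rule_format]) (simp add: H_def le_letter_bound)
  next
    case (Conj \<phi> \<psi>)
    then show ?case by (subst F_eq[rule_format]) (simp add: H_def le_letter_bound)
  next
    case (Ex1 x \<phi>)
    have "F (code_mso (Ex1 x \<phi>)) (prod_encode (A, B)) = set_encode
       {prod_encode (0, F (code_mso \<phi>) (prod_encode (remove x A, B))),
        prod_encode (1, F (code_mso \<phi>) (prod_encode (adjoin x A, B)))}"
      by (subst F_eq[rule_format]) (simp add: H_def letter_le_bound adjoin_le remove_le variable_le_code)
    then show ?case by (simp only: Ex1 letter_type.simps set1 if_True if_False)
  next
    case (Ex2 X \<phi>)
    have "F (code_mso (Ex2 X \<phi>)) (prod_encode (A, B)) = set_encode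
       {F (code_mso \<phi>) (prod_encode (A, remove X B)), F (code_mso \<phi>) (prod_encode (A, adjoin X B))}"
      by (subst F_eq[rule_format]) (simp add: H_def letter_le_bound adjoin_le remove_le variable_le_code)
    then show ?case by (simp only: Ex2 letter_type.simps set2 if_True if_False)
  qed (subst F_eq[rule_format], simp add: H_def)+
  with F show ?thesis by blast
qed

lemma op_power_eq_rec: "op_power m e n = rec_nat e (\<lambda>_ r. m r e) n"
  by (induction n) auto

lemma computable_type_acc:
  "\<exists>F. computable2 F \<and> (\<forall>\<phi> s e. F (code_mso \<phi>) (prod_encode (s, e)) = of_bool (type_acc \<phi> s e))"
proof -
  obtain bound where bound: "computable bound" "\<And>\<phi>. bound (code_mso \<phi>) = type_bound \<phi>"
    using computable_type_bound by blast
  obtain mul where mul: "computable2 mul"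
    "\<And>\<phi> s t. mul (code_mso \<phi>) (prod_encode (s, t)) = type_op \<phi> s t"
    using computable_type_op by blast
  \<comment> \<open>Powers are taken with \<open>mul c\<close> at the code of the quantified formula
    itself, whose product already is the required set product; only the acceptance test
    \<open>ac\<close> of the body remains to be supplied by recursion.\<close>
  define set_acc' where "set_acc' c b ac z = (of_bool (\<exists>i<2 ^ b. \<exists>j<2 ^ b. \<exists>s<b. \<exists>e<b.
     s \<in> set_decode (mul c (prod_encode (pfst z,
       op_power (\<lambda>r e. mul c (prod_encode (r, e))) (psnd z) i))) \<and>
     e \<in> set_decode (op_power (\<lambda>r e. mul c (prod_encode (r, e))) (psnd z) j) \<and> ac s e) :: nat)"
    for c b :: nat and ac :: "nat \<Rightarrow> nat \<Rightarrow> bool" and z :: nat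
  have set_acc': "set_acc' (code_mso \<phi>) b ac (prod_encode (S, E)) = of_bool (set_acc m ac' b S E)"
    if "type_op \<phi> = set_op m" "\<And>s e. s < b \<Longrightarrow> e < b \<Longrightarrow> ac s e = ac' s e" for \<phi> b ac ac' S E m
    unfolding set_acc'_def set_acc_def mul(2) that(1) using that(2) by (simp cong: conj_cong)
  define H where "H c z g =
    (if pfst c = 0 \<or> pfst c = 2 then of_bool (pfst z \<noteq> 0 \<and> psnd z \<noteq> 0)
     else if pfst c = 1 then of_bool (pfst (pfst z) \<noteq> 0 \<and> pfst (psnd z) \<noteq> 0 \<and> pfst (psnd (pfst z)) = 0 \<and>
       psnd (psnd (pfst z)) = pfst (psnd (psnd z)) \<and> psnd (psnd (psnd z)) = pfst (psnd (psnd z)))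
     else if pfst c = 3 then 1 - g (psnd c) z
     else if pfst c = 4 then
       g (pfst (psnd c)) (prod_encode (pfst (pfst z), pfst (psnd z))) *
       g (psnd (psnd c)) (prod_encode (psnd (pfst z), psnd (psnd z)))
     else if pfst c = 5 then set_acc' c (prod_encode (3, bound (psnd (psnd c))))
       (\<lambda>s e. (pfst s = 1 \<and> pfst e = 0) \<and> g (psnd (psnd c)) (prod_encode (psnd s, psnd e)) \<noteq> 0) z
     else set_acc' c (bound (psnd (psnd c))) (\<lambda>s e. g (psnd (psnd c)) (prod_encode (s, e)) \<noteq> 0) z)"
    for c z :: nat and g :: "nat \<Rightarrow> nat \<Rightarrow> nat"
  have cb: "computable (\<lambda>x. bound (f x))" if "computable f" for f
    using computable_comp[OF bound(1) that] .
  have H: "computable (\<lambda>p. H (pfst p) (pfst (psnd p)) (table_lookup (psnd (psnd p))))"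
    unfolding H_def set_acc'_def op_power_eq_rec
    by (intro computable_table_intros computable_rec computable2_app[OF mul(1)] cb)
  \<comment> \<open>For conjunction the arguments only shrink below \<open>z\<close>. At a
    quantifier the candidates \<open>s\<close> and \<open>e\<close> are below the bound
    \<open>b\<close> of the body, and \<open>bound c = 2 ^ b\<close> exceeds
    \<open>b\<close>.\<close>
  have B: "computable (\<lambda>p. psnd p + prod_encode (bound (pfst p), bound (pfst p)))"
    by (intro computable_intros cb)
  obtain F where F: "computable2 F"
    and F_eq: "\<forall>c z. F c z = H c z
      (\<lambda>d y. if d < c \<and> y \<le> z + prod_encode (bound c, bound c) then F d y else 0)"
    using computable_nested_recursion[of H "\<lambda>c z. z + prod_encode (bound c, bound c)", OF H B] by (elim exE conjE)
  have le: "prod_encode (pfst s, pfst t) \<le> prod_encode (s, t) + k"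
    "prod_encode (psnd s, psnd t) \<le> prod_encode (s, t) + k" for s t k
    by (simp_all add: prod_encode_mono pfst_le psnd_le trans_le_add1)
  have le': "prod_encode (s, e) \<le> k + prod_encode (2 ^ b, 2 ^ b)"
    "prod_encode (psnd s, psnd e) \<le> k + prod_encode (2 ^ b, 2 ^ b)" if "s < b" "e < b" for s e b k
  proof -
    have "b < 2 ^ b" by (rule less_exp)
    with that psnd_le[of s] psnd_le[of e]
    have "s \<le> 2 ^ b" "e \<le> 2 ^ b" "psnd s \<le> 2 ^ b" "psnd e \<le> 2 ^ b" by linarith+
    then show "prod_encode (s, e) \<le> k + prod_encode (2 ^ b, 2 ^ b)"
      "prod_encode (psnd s, psnd e) \<le> k + prod_encode (2 ^ b, 2 ^ b)"
      by (simp_all add: trans_le_add2 prod_encode_mono)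
  qed
  have "F (code_mso \<phi>) (prod_encode (s, e)) = of_bool (type_acc \<phi> s e)" for \<phi> s e
  proof (induction \<phi> arbitrary: s e)
    case (Conj \<phi> \<psi>)
    then show ?case by (subst F_eq[rule_format]) (simp add: H_def le)
  next
    case (Ex1 x \<phi>)
    have "F (code_mso (Ex1 x \<phi>)) (prod_encode (s, e)) =
      set_acc' (code_mso (Ex1 x \<phi>)) (prod_encode (3, type_bound \<phi>))
        (\<lambda>s e. (pfst s = 1 \<and> pfst e = 0) \<and>
          (if prod_encode (psnd s, psnd e) \<le> k + prod_encode (2 ^ prod_encode (3, type_bound \<phi>), 2 ^ prod_encode (3, type_bound \<phi>))
           then F (code_mso \<phi>) (prod_encode (psnd s, psnd e)) else 0) \<noteq> 0) (prod_encode (s, e))"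
      if "k = prod_encode (s, e)" for k
      unfolding that using bound(2)[of "Ex1 x \<phi>"] by (subst F_eq[rule_format]) (simp add: H_def bound(2))
    from this[OF refl] show ?case
      by (simp only: type_acc.simps) (rule set_acc', simp, simp add: le' Ex1)
  next
    case (Ex2 X \<phi>)
    have "F (code_mso (Ex2 X \<phi>)) (prod_encode (s, e)) =
      set_acc' (code_mso (Ex2 X \<phi>)) (type_bound \<phi>)
        (\<lambda>s e. (if prod_encode (s, e) \<le> k + prod_encode (2 ^ type_bound \<phi>, 2 ^ type_bound \<phi>)
           then F (code_mso \<phi>) (prod_encode (s, e)) else 0) \<noteq> 0) (prod_encode (s, e))"
      if "k = prod_encode (s, e)" for k
      unfolding that using bound(2)[of "Ex2 X \<phi>"] by (subst F_eq[rule_format]) (simp add: H_def bound(2))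
    from this[OF refl] show ?case
      by (simp only: type_acc.simps) (rule set_acc', simp, simp add: le' Ex2)
  qed (subst F_eq[rule_format], simp add: H_def)+
  with F show ?thesis by blast
qed


section \<open>Decidability of well-formedness\<close>

text \<open>Recognising codes and checking free variables are one recursion: the numerals
  \<open>A\<close> and \<open>B\<close> hold the variables currently allowed, and a quantifier
  adjoins the variable it binds.\<close>

lemma computable_mso_code:
  "\<exists>F. computable2 F \<and> (\<forall>c A B. F c (prod_encode (A, B)) =
     of_bool (\<exists>\<phi>. c = code_mso \<phi> \<and> free1 \<phi> \<subseteq> set_decode A \<and> free2 \<phi> \<subseteq> set_decode B))"
proof -
  define H where "H c z g =
    (if pfst c = 0 \<or> pfst c = 1 then
       of_bool (pfst (psnd c) \<in> set_decode (pfst z) \<and> psnd (psnd c) \<in> set_decode (pfst z))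
     else if pfst c = 2 then
       of_bool (pfst (psnd c) \<in> set_decode (pfst z) \<and> psnd (psnd c) \<in> set_decode (psnd z))
     else if pfst c = 3 then g (psnd c) z
     else if pfst c = 4 then g (pfst (psnd c)) z * g (psnd (psnd c)) z
     else if pfst c = 5 then g (psnd (psnd c)) (prod_encode (adjoin (pfst (psnd c)) (pfst z), psnd z))
     else if pfst c = 6 then g (psnd (psnd c)) (prod_encode (pfst z, adjoin (pfst (psnd c)) (psnd z)))
     else 0)"
    for c z :: nat and g :: "nat \<Rightarrow> nat \<Rightarrow> nat"
  have H: "computable (\<lambda>p. H (pfst p) (pfst (psnd p)) (table_lookup (psnd (psnd p))))"
    unfolding H_def by (intro computable_table_intros)
  have B: "computable (\<lambda>p. prod_encode (psnd p + 2 ^ pfst p, psnd p + 2 ^ pfst p))"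
    by (intro computable_intros)
  obtain F where F: "computable2 F"
    and F_eq: "\<forall>c z. F c z = H c z
      (\<lambda>d y. if d < c \<and> y \<le> prod_encode (z + 2 ^ c, z + 2 ^ c) then F d y else 0)"
    using computable_nested_recursion[of H "\<lambda>c z. prod_encode (z + 2 ^ c, z + 2 ^ c)", OF H B]
    by (elim exE conjE)
  have code: "F (code_mso \<phi>) (prod_encode (A, B)) = of_bool (free1 \<phi> \<subseteq> set_decode A \<and> free2 \<phi> \<subseteq> set_decode B)"
    for \<phi> A B
  proof (induction \<phi> arbitrary: A B)
    case (Neg \<phi>)
    then show ?case by (subst F_eq[rule_format]) (simp add: H_def le_letter_bound)
  next
    case (Conj \<phi> \<psi>)
    then show ?case by (subst F_eq[rule_format]) (auto simp: H_def le_letter_bound)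
  next
    case (Ex1 x \<phi>)
    have "F (code_mso (Ex1 x \<phi>)) (prod_encode (A, B)) = F (code_mso \<phi>) (prod_encode (adjoin x A, B))"
      by (subst F_eq[rule_format]) (simp add: H_def letter_le_bound adjoin_le variable_le_code)
    then show ?case by (simp add: Ex1 subset_insert_iff)
  next
    case (Ex2 X \<phi>)
    have "F (code_mso (Ex2 X \<phi>)) (prod_encode (A, B)) = F (code_mso \<phi>) (prod_encode (A, adjoin X B))"
      by (subst F_eq[rule_format]) (simp add: H_def letter_le_bound adjoin_le variable_le_code)
    then show ?case by (simp add: Ex2 subset_insert_iff)
  qed (subst F_eq[rule_format], simp add: H_def)+
  \<comment> \<open>The equation \<open>code\<close> concerns only numbers that are codes.
    Conversely, a nonzero value forces nonzero values at the parts, so by induction the number is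
    assembled from codes by some constructor.\<close>
  have range: "c \<in> range code_mso" if "F c z \<noteq> 0" for c z
    using that
  proof (induction c arbitrary: z rule: less_induct)
    case (less c)
    obtain k r where c: "c = prod_encode (k, r)" by (metis prod_encode_pfst_psnd)
    obtain p q where r: "r = prod_encode (p, q)" by (metis prod_encode_pfst_psnd)
    from less.prems have ne: "H c z (\<lambda>d y. if d < c \<and> y \<le> prod_encode (z + 2 ^ c, z + 2 ^ c) then F d y else 0) \<noteq> 0"
      using F_eq by metis
    consider "k = 0" | "k = 1" | "k = 2" | "k = 3" | "k = 4" | "k = 5" | "k = 6" | "k > 6"
      by linarith
    then show ?case
    proof cases
      case 1
      then have "c = code_mso (Eq p q)" by (simp add: c r)
      then show ?thesis by blast
    next
      case 2
      then have "c = code_mso (Succ p q)" by (simp add: c r)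
      then show ?thesis by blast
    next
      case 3
      then have "c = code_mso (Mem p q)" by (simp add: c r)
      then show ?thesis by blast
    next
      case 4
      then have "r < c" "F r z \<noteq> 0"
        using ne by (auto simp: H_def c split: if_splits)
      then obtain \<phi> where "r = code_mso \<phi>" using less.IH by blast
      then have "c = code_mso (Neg \<phi>)" using 4 by (simp add: c)
      then show ?thesis by blast
    next
      case 5
      then have "p < c" "F p z \<noteq> 0" "q < c" "F q z \<noteq> 0"
        using ne by (auto simp: H_def c r split: if_splits)
      then obtain \<phi> \<psi> where "p = code_mso \<phi>" "q = code_mso \<psi>" using less.IH by blast
      then have "c = code_mso (Conj \<phi> \<psi>)" using 5 by (simp add: c r)
      then show ?thesis by blast
    next
      case 6
      then have "q < c" "F q (prod_encode (adjoin p (pfst z), psnd z)) \<noteq> 0"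
        using ne by (auto simp: H_def c r split: if_splits)
      then obtain \<phi> where "q = code_mso \<phi>" using less.IH by blast
      then have "c = code_mso (Ex1 p \<phi>)" using 6 by (simp add: c r)
      then show ?thesis by blast
    next
      case 7
      then have "q < c" "F q (prod_encode (pfst z, adjoin p (psnd z))) \<noteq> 0"
        using ne by (auto simp: H_def c r split: if_splits)
      then obtain \<phi> where "q = code_mso \<phi>" using less.IH by blast
      then have "c = code_mso (Ex2 p \<phi>)" using 7 by (simp add: c r)
      then show ?thesis by blast
    next
      case 8
      then show ?thesis using ne by (simp add: H_def c)
    qed
  qed
  have "F c (prod_encode (A, B)) =
      of_bool (\<exists>\<phi>. c = code_mso \<phi> \<and> free1 \<phi> \<subseteq> set_decode A \<and> free2 \<phi> \<subseteq> set_decode B)" for c A B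
  proof (cases "c \<in> range code_mso")
    case True
    then obtain \<phi> where "c = code_mso \<phi>" by blast
    then show ?thesis by (simp add: code code_mso_inject)
  next
    case False
    then have "F c (prod_encode (A, B)) = 0" using range by blast
    moreover have "\<not> (\<exists>\<phi>. c = code_mso \<phi> \<and> free1 \<phi> \<subseteq> set_decode A \<and> free2 \<phi> \<subseteq> set_decode B)" using False by blast
    ultimately show ?thesis by simp
  qed
  with F show ?thesis by blast
qed

section \<open>Codes of primary-algebra expressions\<close>

lemma computable_pexpr_code:
  "\<exists>F. computable2 F \<and> (\<forall>c n. F c n = of_bool (\<exists>E. c = code_pexpr E \<and> pvars E \<subseteq> {..<n}))"
proof -
  \<comment> \<open>The test \<open>psnd c = 0\<close> singles out the only code with tag 0; a
    nonzero remainder under that tag codes no expression.\<close>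
  define H where "H c z g =
    (if pfst c = 0 then of_bool (psnd c = 0)
     else if pfst c = 1 then of_bool (psnd c < z)
     else if pfst c = 2 then g (pfst (psnd c)) z * g (psnd (psnd c)) z
     else if pfst c = 3 then g (psnd c) z else 0)"
    for c z :: nat and g :: "nat \<Rightarrow> nat \<Rightarrow> nat"
  have H: "computable (\<lambda>p. H (pfst p) (pfst (psnd p)) (table_lookup (psnd (psnd p))))"
    unfolding H_def by (intro computable_table_intros)
  have B: "computable (\<lambda>p. psnd p)" by (intro computable_arith)
  obtain F where F: "computable2 F"
    and F_eq: "\<forall>c x. F c x = H c x (\<lambda>d y. if d < c \<and> y \<le> x then F d y else 0)"
    using computable_nested_recursion[of H "\<lambda>_ z. z", OF H B] by (elim exE conjE)
  have code: "F (code_pexpr E) n = of_bool (pvars E \<subseteq> {..<n})" for E n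
  proof (induction E)
    case (Juxt f g)
    then show ?case by (subst F_eq[rule_format]) (auto simp: H_def)
  qed (subst F_eq[rule_format], simp add: H_def)+
  have range: "c \<in> range code_pexpr" if "F c n \<noteq> 0" for c n
    using that
  proof (induction c rule: less_induct)
    case (less c)
    obtain k r where c: "c = prod_encode (k, r)" by (metis prod_encode_pfst_psnd)
    obtain p q where r: "r = prod_encode (p, q)" by (metis prod_encode_pfst_psnd)
    from less.prems have ne: "H c n (\<lambda>d y. if d < c \<and> y \<le> n then F d y else 0) \<noteq> 0"
      using F_eq by metis
    consider "k = 0" | "k = 1" | "k = 2" | "k = 3" | "k > 3"
      by linarith
    then show ?case
    proof cases
      case 1
      then have "c = code_pexpr Void" using ne by (simp add: H_def c)
      then show ?thesis by blast
    next
      case 2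
      then have "c = code_pexpr (Var r)" by (simp add: c)
      then show ?thesis by blast
    next
      case 3
      then have "p < c" "F p n \<noteq> 0" "q < c" "F q n \<noteq> 0"
        using ne by (auto simp: H_def c r split: if_splits)
      then obtain f g where "p = code_pexpr f" "q = code_pexpr g" using less.IH by blast
      then have "c = code_pexpr (Juxt f g)" using 3 by (simp add: c r)
      then show ?thesis by blast
    next
      case 4
      then have "r < c" "F r n \<noteq> 0"
        using ne by (auto simp: H_def c split: if_splits)
      then obtain f where "r = code_pexpr f" using less.IH by blast
      then have "c = code_pexpr (Encl f)" using 4 by (simp add: c)
      then show ?thesis by blast
    next
      case 5
      then show ?thesis using ne by (simp add: H_def c)
    qed
  qed
  have "F c n = of_bool (\<exists>E. c = code_pexpr E \<and> pvars E \<subseteq> {..<n})" for c n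
  proof (cases "c \<in> range code_pexpr")
    case True
    then obtain E where "c = code_pexpr E" by blast
    then show ?thesis by (simp add: code code_pexpr_inject)
  next
    case False
    then have "F c (n) = 0" using range by blast
    moreover have "\<not> (\<exists>E. c = code_pexpr E \<and> pvars E \<subseteq> {..<n})" using False by blast
    ultimately show ?thesis by simp
  qed
  with F show ?thesis by blast
qed

lemma computable_peval:
  "\<exists>F. computable2 F \<and> (\<forall>E x. F (code_pexpr E) x = of_bool (peval (\<lambda>i. i \<in> set_decode x) E))"
proof -
  define H where "H c z g =
    (if pfst c = 0 then 0
     else if pfst c = 1 then of_bool (psnd c \<in> set_decode z)
     else if pfst c = 2 then of_bool (g (pfst (psnd c)) z \<noteq> 0 \<or> g (psnd (psnd c)) z \<noteq> 0)
     else 1 - g (psnd c) z)"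
    for c z :: nat and g :: "nat \<Rightarrow> nat \<Rightarrow> nat"
  have H: "computable (\<lambda>p. H (pfst p) (pfst (psnd p)) (table_lookup (psnd (psnd p))))"
    unfolding H_def by (intro computable_table_intros)
  have B: "computable (\<lambda>p. psnd p)" by (intro computable_arith)
  obtain F where F: "computable2 F"
    and F_eq: "\<forall>c x. F c x = H c x (\<lambda>d y. if d < c \<and> y \<le> x then F d y else 0)"
    using computable_nested_recursion[of H "\<lambda>_ z. z", OF H B] by (elim exE conjE)
  have "F (code_pexpr E) x = of_bool (peval (\<lambda>i. i \<in> set_decode x) E)" for E x
    by (induction E) (subst F_eq[rule_format], simp add: H_def)+
  with F show ?thesis by blast
qed

section \<open>Re-entry systems on codes\<close>

text \<open>The code of a nonempty list is the successor of the pair of its head and the code of its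
  tail, hence \<open>r - 1\<close>. The code 0 of the empty list is fixed by the step, so dropping
  beyond the end is harmless.\<close>

definition code_drop :: "nat \<Rightarrow> nat \<Rightarrow> nat" where
  "code_drop l i = rec_nat l (\<lambda>_ r. psnd (r - 1)) i"

definition code_nth :: "nat \<Rightarrow> nat \<Rightarrow> nat" where
  "code_nth l i = pfst (code_drop l i - 1)"

text \<open>The proper drops are counted, since exactly the empty list has code 0. Summing up to the
  code itself is enough because a list is never longer than its code.\<close>

definition code_length :: "nat \<Rightarrow> nat" where
  "code_length l = (\<Sum>i<l. of_bool (code_drop l i \<noteq> 0))"

lemma code_drop_list_encode: "code_drop (list_encode xs) i = list_encode (drop i xs)"
proof (induction i)
  case (Suc i)
  have "psnd 0 = 0" using psnd_le[of 0] by simp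
  then have "psnd (list_encode ys - 1) = list_encode (tl ys)" for ys
    by (cases ys) simp_all
  with Suc show ?case by (simp add: code_drop_def drop_Suc tl_drop)
qed (simp add: code_drop_def)

lemma code_nth_list_encode: "i < length xs \<Longrightarrow> code_nth (list_encode xs) i = xs ! i"
  by (simp add: code_nth_def code_drop_list_encode flip: Cons_nth_drop_Suc)

lemma code_length_list_encode: "code_length (list_encode xs) = length xs"
proof -
  have le: "length ys \<le> list_encode ys" for ys
  proof (induction ys)
    case (Cons y ys)
    then show ?case using le_prod_encode_2[of "list_encode ys" y] by simp
  qed simp
  have "list_encode ys = 0 \<longleftrightarrow> ys = []" for ys
    by (cases ys) simp_all
  then have "code_length (list_encode xs) = card ({..<list_encode xs} \<inter> {i. i < length xs})"
    unfolding code_length_def code_drop_list_encode by (simp add: not_le)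
  also have "{..<list_encode xs} \<inter> {i. i < length xs} = {..<length xs}"
    using le[of xs] by auto
  finally show ?thesis by simp
qed

lemma computable_code_drop: "computable f \<Longrightarrow> computable g \<Longrightarrow> computable (\<lambda>x. code_drop (f x) (g x))"
  unfolding code_drop_def by (intro computable_rec computable_intros)

lemma computable_code_nth: "computable f \<Longrightarrow> computable g \<Longrightarrow> computable (\<lambda>x. code_nth (f x) (g x))"
  unfolding code_nth_def by (intro computable_code_drop computable_intros)

lemma computable_code_length:
  assumes "computable f"
  shows "computable (\<lambda>x. code_length (f x))"
proof -
  have "computable code_length"
    unfolding code_length_def by (intro computable_code_drop computable_intros)
  from computable_comp[OF this assms] show ?thesis .
qed

lemmas computable_list_intros = computable_intros computable_code_nth computable_code_length

text \<open>Every number codes some list of numbers, so only the entries need testing, with the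
  length of the list as the dimension.\<close>

lemma decid_code_system:
  "decid (\<lambda>e. \<exists>Es. e = code_system Es \<and> reentry_system (length Es) Es)"
proof -
  obtain F where F: "computable2 F"
    and F_eq: "\<And>c n. F c n = of_bool (\<exists>E. c = code_pexpr E \<and> pvars E \<subseteq> {..<n})"
    using computable_pexpr_code by blast
  have "(\<exists>Es. e = code_system Es \<and> reentry_system (length Es) Es) \<longleftrightarrow>
      (\<forall>i<code_length e. F (code_nth e i) (code_length e) \<noteq> 0)" (is "?L \<longleftrightarrow> ?R") for e
  proof
    assume ?L
    then obtain Es where "e = list_encode (map code_pexpr Es)" "\<forall>E\<in>set Es. pvars E \<subseteq> {..<length Es}"
      unfolding code_system_def reentry_system_def by blast
    then show ?R
      by (auto simp: code_length_list_encode code_nth_list_encode F_eq code_pexpr_inject)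
  next
    assume R: ?R
    define l where "l = list_decode e"
    have e: "e = list_encode l" by (simp add: l_def)
    have "\<forall>i<length l. \<exists>E. l ! i = code_pexpr E \<and> pvars E \<subseteq> {..<length l}"
      using R by (simp add: e code_length_list_encode code_nth_list_encode F_eq)
    then obtain f where f: "\<And>i. i < length l \<Longrightarrow> l ! i = code_pexpr (f i) \<and> pvars (f i) \<subseteq> {..<length l}"
      by metis
    have "l = map code_pexpr (map f [0..<length l])"
      by (rule nth_equalityI) (simp_all add: f)
    then have "e = code_system (map f [0..<length l])"
      by (simp only: e code_system_def)
    moreover have "reentry_system (length (map f [0..<length l])) (map f [0..<length l])"
      using f by (auto simp: reentry_system_def)
    ultimately show ?L by blast
  qed
  moreover have "decid (\<lambda>e. \<forall>i<code_length e. F (code_nth e i) (code_length e) \<noteq> 0)"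
    by (intro computable_list_intros computable2_app[OF F])
  ultimately show ?thesis by simp
qed

lemma decid_code_state: "decid (\<lambda>w. \<exists>a. w = code_state a)"
proof -
  have "(\<exists>a. w = code_state a) \<longleftrightarrow> (\<forall>i<code_length w. code_nth w i < 2)" (is "?L \<longleftrightarrow> ?R") for w
  proof
    assume ?L
    then show ?R
      by (auto simp: code_state_def code_length_list_encode code_nth_list_encode)
  next
    assume R: ?R
    define l where "l = list_decode w"
    have w: "w = list_encode l" by (simp add: l_def)
    have "\<forall>i<length l. l ! i < 2"
      using R by (simp add: w code_length_list_encode code_nth_list_encode)
    then have "l = map of_bool (map (\<lambda>x. x \<noteq> 0) l)"
      by (intro nth_equalityI) (auto simp: less_2_cases_iff)
    then have "w = code_state (map (\<lambda>x. x \<noteq> 0) l)"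
      by (simp only: w code_state_def)
    then show ?L by blast
  qed
  moreover have "decid (\<lambda>w. \<forall>i<code_length w. code_nth w i < 2)"
    by (intro computable_list_intros)
  ultimately show ?thesis by simp
qed

text \<open>States are represented by numbers below \<open>2 ^ n\<close>, coordinate \<open>i\<close> being the \<open>i\<close>-th binary digit.\<close>

definition state_mask :: "bool list \<Rightarrow> nat" where
  "state_mask a = set_encode {i. i < length a \<and> a ! i}"

lemma set_decode_state_mask: "set_decode (state_mask a) = {i. i < length a \<and> a ! i}"
  unfolding state_mask_def by (rule set_encode_inverse) simp

lemma state_mask_inject:
  assumes "length a = length b"
  shows "state_mask a = state_mask b \<longleftrightarrow> a = b"
proof
  assume "state_mask a = state_mask b"
  then have "{i. i < length a \<and> a ! i} = {i. i < length b \<and> b ! i}"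
    by (simp flip: set_decode_state_mask)
  then show "a = b" using assms by (intro nth_equalityI) (auto simp: set_eq_iff)
qed simp

lemma state_mask_surj:
  assumes "x < 2 ^ n"
  obtains a where "length a = n" "state_mask a = x"
proof -
  define a where "a = map (\<lambda>i. i \<in> set_decode x) [0..<n]"
  have "i < n" if "i \<in> set_decode x" for i
  proof (rule ccontr)
    assume "\<not> i < n"
    then have "x < 2 ^ i" using assms by (meson less_le_trans not_le one_le_numeral power_increasing)
    then show False using that by (simp add: set_decode_def)
  qed
  then have "{i. i < length a \<and> a ! i} = set_decode x" by (auto simp: a_def)
  then have "state_mask a = x" by (simp add: state_mask_def)
  with that[of a] show thesis by (simp add: a_def)
qed

lemma state_mask_less: "state_mask a < 2 ^ length a"
  unfolding state_mask_def by (rule set_encode_less) auto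

lemma peval_cong: "(\<And>i. i \<in> pvars E \<Longrightarrow> v i = v' i) \<Longrightarrow> peval v E = peval v' E"
  by (induction E) auto

lemma length_trajectory: "length Es = n \<Longrightarrow> length a = n \<Longrightarrow> length (trajectory Es a t) = n"
  by (cases t) (simp_all add: trajectory_def update_def)

lemma trajectory_Suc: "trajectory Es a (Suc t) = update Es (trajectory Es a t)"
  by (simp add: trajectory_def)

text \<open>Computability of the ternary function is stated as closure under substitution, the form
  in which \<open>intro\<close> uses it inside larger expressions.\<close>

lemma computable_trajectory:
  "\<exists>F. (\<forall>f g h. computable f \<longrightarrow> computable g \<longrightarrow> computable h \<longrightarrow> computable (\<lambda>x. F (f x) (g x) (h x))) \<and>
     (\<forall>Es a t. reentry_system (length a) Es \<longrightarrow>
       F (code_system Es) (state_mask a) t = state_mask (trajectory Es a t))"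
proof -
  obtain ev where ev: "computable2 ev"
    and ev_eq: "\<And>E x. ev (code_pexpr E) x = of_bool (peval (\<lambda>i. i \<in> set_decode x) E)"
    using computable_peval by blast
  define step where "step e x = set_encode {i. i < code_length e \<and> ev (code_nth e i) x \<noteq> 0}" for e x
  define F where "F e x t = rec_nat x (\<lambda>_ r. step e r) t" for e x t
  have "computable (\<lambda>p. F (pfst p) (pfst (psnd p)) (psnd (psnd p)))"
    unfolding F_def step_def by (intro computable_rec computable_list_intros computable2_app[OF ev])
  then have F: "computable (\<lambda>x. F (f x) (g x) (h x))" if "computable f" "computable g" "computable h" for f g h
    using computable_comp[of "\<lambda>p. F (pfst p) (pfst (psnd p)) (psnd (psnd p))"
        "\<lambda>x. prod_encode (f x, prod_encode (g x, h x))"] that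
    by (simp add: computable_prod_encode)
  have step: "step (code_system Es) (state_mask a) = state_mask (update Es a)"
    if Es: "reentry_system (length a) Es" for Es a
  proof -
    have len: "length Es = length a" using Es by (simp add: reentry_system_def)
    have "peval (\<lambda>i. i \<in> set_decode (state_mask a)) (Es ! i) = update Es a ! i" if "i < length Es" for i
    proof -
      have "pvars (Es ! i) \<subseteq> {..<length a}" using Es that by (simp add: reentry_system_def)
      then have "peval (\<lambda>i. i \<in> set_decode (state_mask a)) (Es ! i) = peval (\<lambda>i. a ! i) (Es ! i)"
        by (intro peval_cong) (auto simp: set_decode_state_mask)
      then show ?thesis using that by (simp add: update_def)
    qed
    then have "{i. i < code_length (code_system Es) \<and> ev (code_nth (code_system Es) i) (state_mask a) \<noteq> 0}
        = {i. i < length (update Es a) \<and> update Es a ! i}"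
      by (auto simp: code_system_def code_length_list_encode code_nth_list_encode ev_eq update_def)
    then show ?thesis by (simp add: step_def state_mask_def)
  qed
  have "F (code_system Es) (state_mask a) t = state_mask (trajectory Es a t)"
    if "reentry_system (length a) Es" for Es a t
  proof (induction t)
    case (Suc t)
    have "length (trajectory Es a t) = length a"
      using that by (intro length_trajectory) (simp_all add: reentry_system_def)
    then have "step (code_system Es) (state_mask (trajectory Es a t)) = state_mask (trajectory Es a (Suc t))"
      using that by (simp add: step trajectory_Suc)
    with Suc show ?case by (simp add: F_def)
  qed (simp add: F_def trajectory_def)
  with F show ?thesis by blast
qed

section \<open>Trajectories\<close>

lemma trajectory_ultimately_periodic:
  assumes "reentry_system n Es" "length a = n"
  obtains p q where "ultimately_periodic (trajectory Es a) p q" "p + q \<le> 2 ^ n"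
proof -
  have card: "card {b :: bool list. length b = n} = 2 ^ n" "finite {b :: bool list. length b = n}"
    using card_lists_length_eq[of "UNIV :: bool set" n] finite_lists_length_eq[of "UNIV :: bool set" n]
    by simp_all
  have "trajectory Es a k \<in> {b. length b = n}" for k
    using assms by (simp add: length_trajectory reentry_system_def)
  from orbit_ultimately_periodic[of "trajectory Es a" "update Es", OF trajectory_Suc this card(2)]
  obtain p q where "q > 0" "p + q \<le> card {b :: bool list. length b = n}"
    "\<And>k. k \<ge> p \<Longrightarrow> trajectory Es a (k + q) = trajectory Es a k"
    by blast
  then show thesis using that[of p q] card(1) by (simp add: ultimately_periodic_def)
qed

text \<open>The preperiod is at most \<open>2 ^ n\<close>, so time \<open>2 ^ n\<close> is already
  periodic, and \<open>q\<close> is the period minus one. A decision procedure can therefore start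
  at time \<open>2 ^ n\<close> and search only for a return.\<close>

lemma trajectory_returns:
  assumes "reentry_system n Es" "length a = n"
  shows "\<exists>q<2 ^ n. trajectory Es a (Suc (2 ^ n + q)) = trajectory Es a (2 ^ n)"
proof -
  obtain p q where pq: "ultimately_periodic (trajectory Es a) p q" "p + q \<le> 2 ^ n"
    using trajectory_ultimately_periodic[OF assms] .
  then have "trajectory Es a (Suc (2 ^ n + (q - 1))) = trajectory Es a (2 ^ n)" "q - 1 < 2 ^ n"
    by (auto simp: ultimately_periodic_def)
  then show ?thesis by blast
qed

lemma trajectory_eq_iff:
  assumes "reentry_system n Es" "length a = n"
  shows "trajectory Es a = trajectory Es' a' \<longleftrightarrow> (\<forall>t<Suc (2 ^ n). trajectory Es a t = trajectory Es' a' t)"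
proof
  assume R: "\<forall>t<Suc (2 ^ n). trajectory Es a t = trajectory Es' a' t"
  obtain p q where "ultimately_periodic (trajectory Es a) p q" and pq: "p + q \<le> 2 ^ n"
    using trajectory_ultimately_periodic[OF assms] .
  then have "q > 0" and per: "\<And>k. k \<ge> p \<Longrightarrow> trajectory Es a (k + q) = trajectory Es a k"
    by (auto simp: ultimately_periodic_def)
  \<comment> \<open>Both \<open>p\<close> and \<open>p + q\<close> lie in the range of assumed
    agreement, so the second trajectory repeats its state there too, and the repetition persists
    because each state determines the next.\<close>
  have per': "trajectory Es' a' (k + q) = trajectory Es' a' k" if "k \<ge> p" for k
    using that
  proof (induction rule: dec_induct)
    case base
    show ?case using R per[of p] pq by (metis le_imp_less_Suc le_refl add_leD1)
  qed (simp add: trajectory_Suc)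
  show "trajectory Es a = trajectory Es' a'"
  proof
    fix t
    show "trajectory Es a t = trajectory Es' a' t"
    proof (induction t rule: less_induct)
      case (less t)
      show ?case
      proof (cases "t < p + q")
        case True
        then show ?thesis using R pq by simp
      next
        case False
        then have "t - q < t" "t - q \<ge> p" "t - q + q = t" using \<open>q > 0\<close> by simp_all
        then show ?thesis using less.IH per[of "t - q"] per'[of "t - q"] by metis
      qed
    qed
  qed
qed simp

lemma seg_shift:
  assumes "i < j" "\<And>t. t \<ge> i \<Longrightarrow> g (t + d) = g t"
  shows "seg m g (i + d) (j + d) = seg m g i j"
  using assms(1) by (induction rule: seg_induct) (use assms(2) in \<open>simp_all add: seg_Suc\<close>)

text \<open>The word of the trajectory is factorised at \<open>0, p, p + q, p + 2 q, ...\<close>.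
  Positivity of \<open>p\<close> and \<open>q\<close> keeps all blocks nonempty, and any return to
  the state at time \<open>p\<close> will do, whether or not \<open>q\<close> is the least
  period.\<close>

lemma trajectory_sat_iff:
  assumes Es: "reentry_system n Es" "length a = n" and \<phi>: "mso_formula n \<phi>"
    and pq: "p > 0" "q > 0" "trajectory Es a (p + q) = trajectory Es a p"
  defines "g \<equiv> \<lambda>t. letter_type \<phi> (\<lambda>_. False, \<lambda>X. X \<in> set_decode (state_mask (trajectory Es a t)))"
  shows "trajectory_sat Es a \<phi> \<longleftrightarrow>
    type_acc \<phi> (seg (type_op \<phi>) g 0 p) (seg (type_op \<phi>) g p (p + q))"
proof -
  define w where "w t = (\<lambda>x :: nat. 0 = t, \<lambda>X. t \<in> {t. trajectory Es a t ! X})" for t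
  have len: "length (trajectory Es a t) = n" for t
    using Es by (intro length_trajectory) (simp_all add: reentry_system_def)
  \<comment> \<open>The word \<open>w\<close> of the dummy assignment has a one at time 0 in every
    first-order track, \<open>g\<close> has none; the letter types coincide because
    \<open>\<phi>\<close> has no free first-order variables and its free set variables are below
    \<open>n\<close>.\<close>
  have g: "letter_type \<phi> (w t) = g t" for t
    unfolding g_def w_def
    by (rule letter_type_cong) (use \<phi> in \<open>auto simp: mso_formula_def set_decode_state_mask len\<close>)
  have "trajectory Es a (t + q) = trajectory Es a t" if "t \<ge> p" for t
    using that by (induction rule: dec_induct) (simp_all add: pq trajectory_Suc)
  then have per: "g (t + q) = g t" if "t \<ge> p" for t
    using that by (simp add: g_def)
  define f where "f k = (case k of 0 \<Rightarrow> 0 | Suc k \<Rightarrow> p + k * q)" for k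
  have "f k < f (Suc k)" for k using pq by (cases k) (simp_all add: f_def)
  then have f: "strict_mono f" by (simp add: strict_mono_Suc_iff)
  have segs: "seg (type_op \<phi>) g (p + k * q) (p + Suc k * q) = seg (type_op \<phi>) g p (p + q)" for k
  proof (induction k)
    case (Suc k)
    have "seg (type_op \<phi>) g (p + k * q + q) (p + Suc k * q + q) = seg (type_op \<phi>) g (p + k * q) (p + Suc k * q)"
      using pq by (intro seg_shift per) simp_all
    with Suc show ?case by (simp add: ac_simps)
  qed simp
  have "word_sat \<phi> w \<longleftrightarrow> type_acc \<phi> (seg (type_op \<phi>) g 0 p) (seg (type_op \<phi>) g p (p + q))"
  proof (rule recognises_iff[OF recognises_mso f])
    fix k :: nat assume "k \<ge> 1"
    then obtain k' where "k = Suc k'" by (cases k) auto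
    then show "seg (type_op \<phi>) (\<lambda>t. letter_type \<phi> (w t)) (f k) (f (Suc k)) = seg (type_op \<phi>) g p (p + q)"
      using segs[of k'] by (simp add: g f_def)
  qed (simp_all add: g f_def)
  then show ?thesis
    unfolding trajectory_sat_def sat_iff_word_sat w_def .
qed

lemma computable_seg:
  assumes "computable (\<lambda>p. m (pfst p) (pfst (psnd p)) (psnd (psnd p)))"
    and "computable (\<lambda>p. g (pfst p) (psnd p))" "computable i" "computable j"
  shows "computable (\<lambda>x. seg (m x) (g x) (i x) (j x))"
proof -
  have m: "computable (\<lambda>x. m (f x) (g x) (h x))" if "computable f" "computable g" "computable h" for f g h
    using computable_comp[OF assms(1), of "\<lambda>x. prod_encode (f x, prod_encode (g x, h x))"] that
    by (simp add: computable_prod_encode)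
  have g: "computable (\<lambda>x. g (f x) (h x))" if "computable f" "computable h" for f h
    using computable2_app[of g f h] assms(2) that by (simp add: computable2_def)
  have i: "computable (\<lambda>x. i (f x))" if "computable f" for f
    using computable_comp[OF assms(3) that] .
  have "seg m g i j = rec_nat 0 (\<lambda>j r. if i < j then m r (g j) else g j) j" for m g i j
    by (induction j) (simp_all add: seg.simps)
  then show ?thesis
    by (simp only:) (intro computable_rec computable_intros m g i assms(4))
qed

section \<open>The decision procedures\<close>

text \<open>Translates the list code of an input state into the numeral representation in which
  trajectories are computed.\<close>

definition code_mask :: "nat \<Rightarrow> nat" where
  "code_mask w = set_encode {i. i < code_length w \<and> code_nth w i \<noteq> 0}"

lemma code_mask_code_state: "code_mask (code_state a) = state_mask a"
proof -
  have "{i. i < code_length (code_state a) \<and> code_nth (code_state a) i \<noteq> 0} = {i. i < length a \<and> a ! i}"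
    by (auto simp: code_state_def code_length_list_encode code_nth_list_encode)
  then show ?thesis by (simp add: code_mask_def state_mask_def)
qed

lemma computable_code_mask:
  assumes "computable f"
  shows "computable (\<lambda>x. code_mask (f x))"
proof -
  have "computable code_mask"
    unfolding code_mask_def by (intro computable_list_intros)
  from computable_comp[OF this assms] show ?thesis .
qed

lemma code_length_code_system: "code_length (code_system Es) = length Es"
  and code_length_code_state: "code_length (code_state a) = length a"
  by (simp_all add: code_system_def code_state_def code_length_list_encode)

lemma decidable_trajectory_sat:
  "decidable {prod_encode (code_mso \<phi>, prod_encode (code_system Es, code_state a)) | \<phi> Es a.
     \<exists>n. mso_formula n \<phi> \<and> reentry_system n Es \<and> length a = n \<and> trajectory_sat Es a \<phi>}"
    (is "decidable ?A")
proof -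
  obtain T where T: "\<forall>f g h. computable f \<longrightarrow> computable g \<longrightarrow> computable h \<longrightarrow>
      computable (\<lambda>x. T (f x) (g x) (h x))"
    and T_eq: "\<forall>Es a t. reentry_system (length a) Es \<longrightarrow>
      T (code_system Es) (state_mask a) t = state_mask (trajectory Es a t)"
    using computable_trajectory by (elim exE conjE)
  note T = T[rule_format] and T_eq = T_eq[rule_format]
  obtain V where V: "computable2 V"
    and V_eq: "\<And>c A B. V c (prod_encode (A, B)) =
      of_bool (\<exists>\<phi>. c = code_mso \<phi> \<and> free1 \<phi> \<subseteq> set_decode A \<and> free2 \<phi> \<subseteq> set_decode B)"
    using computable_mso_code by blast
  obtain l where l: "computable2 l"
    and l_eq: "\<And>\<phi> A B. l (code_mso \<phi>) (prod_encode (A, B)) =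
      letter_type \<phi> (\<lambda>x. x \<in> set_decode A, \<lambda>X. X \<in> set_decode B)"
    using computable_letter_type by blast
  obtain m where m: "computable2 m"
    and m_eq: "\<And>\<phi> s t. m (code_mso \<phi>) (prod_encode (s, t)) = type_op \<phi> s t"
    using computable_type_op by blast
  obtain ac where ac: "computable2 ac"
    and ac_eq: "\<And>\<phi> s e. ac (code_mso \<phi>) (prod_encode (s, e)) = of_bool (type_acc \<phi> s e)"
    using computable_type_acc by blast
  define sg where "sg c e x i j = seg (\<lambda>s t. m c (prod_encode (s, t))) (\<lambda>t. l c (prod_encode (0, T e x t))) i j"
    for c e x i j
  \<comment> \<open>The allowed first-order variables are given by 0, the code of the empty set, and
    the allowed set variables by the code of \<open>{..<n}\<close>. The conjunct \<open>True\<close>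
    gives that set the shape expected by \<open>computable_set_encode\<close>.\<close>
  define D where "D c e x n \<longleftrightarrow> V c (prod_encode (0, set_encode {i. i < n \<and> True})) \<noteq> 0 \<and>
     (\<exists>q<2 ^ n. T e x (Suc (2 ^ n + q)) = T e x (2 ^ n) \<and>
       ac c (prod_encode (sg c e x 0 (2 ^ n), sg c e x (2 ^ n) (Suc (2 ^ n + q)))) \<noteq> 0)" for c e x n
  have D: "D c (code_system Es) (state_mask a) n \<longleftrightarrow>
      (\<exists>\<phi>. c = code_mso \<phi> \<and> mso_formula n \<phi> \<and> trajectory_sat Es a \<phi>)"
    if Es: "reentry_system n Es" "length a = n" for c Es a n
  proof -
    have "{i. i < n \<and> True} = {..<n}" by auto
    then have V: "V c (prod_encode (0, set_encode {i. i < n \<and> True})) \<noteq> 0 \<longleftrightarrow>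
        (\<exists>\<phi>. c = code_mso \<phi> \<and> mso_formula n \<phi>)"
      by (auto simp: V_eq mso_formula_def)
    have len: "length (trajectory Es a t) = n" for t
      using Es by (intro length_trajectory) (simp_all add: reentry_system_def)
    have T: "T (code_system Es) (state_mask a) t = state_mask (trajectory Es a t)" for t
      using Es by (intro T_eq) simp
    have "(\<exists>q<2 ^ n. T (code_system Es) (state_mask a) (Suc (2 ^ n + q)) = T (code_system Es) (state_mask a) (2 ^ n) \<and>
       ac c (prod_encode (sg c (code_system Es) (state_mask a) 0 (2 ^ n),
         sg c (code_system Es) (state_mask a) (2 ^ n) (Suc (2 ^ n + q)))) \<noteq> 0) \<longleftrightarrow> trajectory_sat Es a \<phi>"
      (is "(\<exists>q<2 ^ n. ?P q \<and> ?Q q) \<longleftrightarrow> _") if c: "c = code_mso \<phi>" and \<phi>: "mso_formula n \<phi>" for \<phi>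
    proof -
      have P: "?P q \<longleftrightarrow> trajectory Es a (Suc (2 ^ n + q)) = trajectory Es a (2 ^ n)" for q
        by (simp only: T) (simp add: state_mask_inject len)
      \<comment> \<open>Every return gives the same, correct verdict, so an existential search over
        \<open>q\<close> is sound; \<open>trajectory_returns\<close> guarantees that it meets at
        least one return.\<close>
      have "?Q q \<longleftrightarrow> trajectory_sat Es a \<phi>" if "?P q" for q
        using trajectory_sat_iff[OF Es \<phi>, of "2 ^ n" "Suc q"] iffD1[OF P that]
        by (simp add: sg_def c m_eq l_eq ac_eq T)
      then show ?thesis
        using trajectory_returns[OF Es] unfolding P by blast
    qed
    then show ?thesis unfolding D_def V by blast
  qed
  define S where "S e \<longleftrightarrow> (\<exists>Es. e = code_system Es \<and> reentry_system (length Es) Es)" for e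
  define W where "W w \<longleftrightarrow> (\<exists>a. w = code_state a)" for w
  define R where "R z \<longleftrightarrow> S (pfst (psnd z)) \<and> W (psnd (psnd z)) \<and>
      code_length (pfst (psnd z)) = code_length (psnd (psnd z)) \<and>
      D (pfst z) (pfst (psnd z)) (code_mask (psnd (psnd z))) (code_length (psnd (psnd z)))" for z
  have "z \<in> ?A \<longleftrightarrow> R z" for z
  proof
    assume "z \<in> ?A"
    then obtain \<phi> Es a where z: "z = prod_encode (code_mso \<phi>, prod_encode (code_system Es, code_state a))"
      and *: "mso_formula (length a) \<phi>" "reentry_system (length a) Es" "trajectory_sat Es a \<phi>"
      by blast
    moreover have "length Es = length a" using *(2) by (simp add: reentry_system_def)
    ultimately show "R z"
      using D[of "length a" Es a "code_mso \<phi>"]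
      by (auto simp: R_def S_def W_def code_length_code_system code_length_code_state code_mask_code_state)
  next
    assume "R z"
    then obtain Es a where e: "pfst (psnd z) = code_system Es" and w: "psnd (psnd z) = code_state a"
      and Es: "reentry_system (length a) Es"
      and Dz: "D (pfst z) (code_system Es) (state_mask a) (length a)"
      by (auto simp: R_def S_def W_def code_length_code_system code_length_code_state code_mask_code_state)
    obtain \<phi> where "pfst z = code_mso \<phi>" "mso_formula (length a) \<phi>" "trajectory_sat Es a \<phi>"
      using Dz D[OF Es] by blast
    moreover have "z = prod_encode (pfst z, prod_encode (pfst (psnd z), psnd (psnd z)))" by simp
    ultimately show "z \<in> ?A" using e w Es by auto
  qed
  moreover have "decid R"
  proof -
    have sg: "computable (\<lambda>x. sg (c x) (e x) (u x) (i x) (j x))"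
      if "computable c" "computable e" "computable u" "computable i" "computable j" for c e u i j
    proof -
      have c: "computable (\<lambda>x. c (f x))" and e: "computable (\<lambda>x. e (f x))" and u: "computable (\<lambda>x. u (f x))"
        if "computable f" for f
        using computable_comp[OF _ that] \<open>computable c\<close> \<open>computable e\<close> \<open>computable u\<close> by blast+
      show ?thesis
        unfolding sg_def
        by (intro computable_seg computable_arith computable2_app[OF m] computable2_app[OF l] T c e u that)
    qed
    show ?thesis
      unfolding R_def D_def S_def W_def
      by (intro computable_list_intros decid_code_system decid_code_state computable_code_mask
          computable2_app[OF V] computable2_app[OF ac] T sg
          computable_comp[OF decid_code_system] computable_comp[OF decid_code_state])
  qed
  ultimately show ?thesis by (simp add: decidable_iff)
qed

lemma decidable_trajectory_eq:
  "decidable {prod_encode (prod_encode (code_system Es, code_system Es'),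
                           prod_encode (code_state a, code_state a')) | Es Es' a a'.
     \<exists>n. reentry_system n Es \<and> reentry_system n Es' \<and> length a = n \<and> length a' = n \<and>
         trajectory Es a = trajectory Es' a'}" (is "decidable ?A")
proof -
  obtain T where T: "\<forall>f g h. computable f \<longrightarrow> computable g \<longrightarrow> computable h \<longrightarrow>
      computable (\<lambda>x. T (f x) (g x) (h x))"
    and T_eq: "\<forall>Es a t. reentry_system (length a) Es \<longrightarrow>
      T (code_system Es) (state_mask a) t = state_mask (trajectory Es a t)"
    using computable_trajectory by (elim exE conjE)
  note T = T[rule_format] and T_eq = T_eq[rule_format]
  define S where "S e \<longleftrightarrow> (\<exists>Es. e = code_system Es \<and> reentry_system (length Es) Es)" for e
  define W where "W w \<longleftrightarrow> (\<exists>a. w = code_state a)" for w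
  define R where "R z \<longleftrightarrow> S (pfst (pfst z)) \<and> S (psnd (pfst z)) \<and> W (pfst (psnd z)) \<and> W (psnd (psnd z)) \<and>
      code_length (pfst (pfst z)) = code_length (pfst (psnd z)) \<and>
      code_length (psnd (pfst z)) = code_length (pfst (psnd z)) \<and>
      code_length (psnd (psnd z)) = code_length (pfst (psnd z)) \<and>
      (\<forall>t<Suc (2 ^ code_length (pfst (psnd z))). T (pfst (pfst z)) (code_mask (pfst (psnd z))) t =
         T (psnd (pfst z)) (code_mask (psnd (psnd z))) t)" for z
  have eq: "trajectory Es a = trajectory Es' a' \<longleftrightarrow>
      (\<forall>t<Suc (2 ^ length a). T (code_system Es) (state_mask a) t = T (code_system Es') (state_mask a') t)"
    if "reentry_system (length a) Es" "reentry_system (length a) Es'" "length a' = length a" for Es Es' a a'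
  proof -
    have "length (trajectory Es a t) = length (trajectory Es' a' t)" for t
      \<comment> \<open>Equal lengths are what makes equality of numerals mean equality of states,
        through \<open>state_mask_inject\<close>.\<close>
      using that by (simp add: length_trajectory reentry_system_def)
    then show ?thesis
      using that trajectory_eq_iff[OF that(1) refl, of Es' a'] by (simp add: T_eq state_mask_inject)
  qed
  have "z \<in> ?A \<longleftrightarrow> R z" for z
  proof
    assume "z \<in> ?A"
    then obtain Es Es' a a' where
      z: "z = prod_encode (prod_encode (code_system Es, code_system Es'), prod_encode (code_state a, code_state a'))"
      and *: "reentry_system (length a) Es" "reentry_system (length a) Es'" "length a' = length a"
        "trajectory Es a = trajectory Es' a'"
      by blast
    moreover have "length Es = length a" "length Es' = length a" using * by (simp_all add: reentry_system_def)
    ultimately show "R z"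
      using eq[of a Es Es' a']
      by (auto simp: R_def S_def W_def code_length_code_system code_length_code_state code_mask_code_state)
  next
    assume "R z"
    then obtain Es Es' a a' where
      e: "pfst (pfst z) = code_system Es" "psnd (pfst z) = code_system Es'"
      and w: "pfst (psnd z) = code_state a" "psnd (psnd z) = code_state a'"
      and Es: "reentry_system (length Es) Es" "reentry_system (length Es') Es'"
      unfolding R_def S_def W_def by blast
    with \<open>R z\<close> have len: "length Es = length a" "length Es' = length a" "length a' = length a"
      and "\<forall>t<Suc (2 ^ length a). T (code_system Es) (state_mask a) t = T (code_system Es') (state_mask a') t"
      by (simp_all add: R_def code_length_code_system code_length_code_state code_mask_code_state)
    then have "trajectory Es a = trajectory Es' a'"
      using eq[of a Es Es' a'] Es by simp
    moreover have "z = prod_encode (prod_encode (pfst (pfst z), psnd (pfst z)), prod_encode (pfst (psnd z), psnd (psnd z)))"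
      by simp
    ultimately show "z \<in> ?A" using e w Es len by auto
  qed
  moreover have "decid R"
    unfolding R_def S_def W_def
    by (intro computable_list_intros computable_code_mask T
        computable_comp[OF decid_code_system] computable_comp[OF decid_code_state])
  ultimately show ?thesis by (simp add: decidable_iff)
qed

lemma decidable_all_trajectories_eq:
  "decidable {prod_encode (code_system Es, code_system Es') | Es Es'.
     \<exists>n. reentry_system n Es \<and> reentry_system n Es' \<and>
         (\<forall>a. length a = n \<longrightarrow> trajectory Es a = trajectory Es' a)}" (is "decidable ?A")
proof -
  obtain T where T: "\<forall>f g h. computable f \<longrightarrow> computable g \<longrightarrow> computable h \<longrightarrow>
      computable (\<lambda>x. T (f x) (g x) (h x))"
    and T_eq: "\<forall>Es a t. reentry_system (length a) Es \<longrightarrow>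
      T (code_system Es) (state_mask a) t = state_mask (trajectory Es a t)"
    using computable_trajectory by (elim exE conjE)
  note T = T[rule_format] and T_eq = T_eq[rule_format]
  define S where "S e \<longleftrightarrow> (\<exists>Es. e = code_system Es \<and> reentry_system (length Es) Es)" for e
  define R where "R z \<longleftrightarrow> S (pfst z) \<and> S (psnd z) \<and> code_length (psnd z) = code_length (pfst z) \<and>
      (\<forall>x<2 ^ code_length (pfst z). T (pfst z) x 1 = T (psnd z) x 1)" for z
  have eq: "(\<forall>a. length a = n \<longrightarrow> trajectory Es a = trajectory Es' a) \<longleftrightarrow>
      (\<forall>x<2 ^ n. T (code_system Es) x 1 = T (code_system Es') x 1)"
    if Es: "reentry_system n Es" "reentry_system n Es'" for Es Es' n
  proof -
    have len: "length Es = n" "length Es' = n" using Es by (simp_all add: reentry_system_def)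
    \<comment> \<open>Time 1 is a single application of the update map, so the trajectory
      computation also serves to compare the maps; the numerals below \<open>2 ^ n\<close> run
      through all states.\<close>
    have T1: "T (code_system Es) (state_mask a) 1 = T (code_system Es') (state_mask a) 1 \<longleftrightarrow>
        update Es a = update Es' a" if "length a = n" for a
      using Es len that by (simp add: T_eq trajectory_def state_mask_inject update_def)
    have "(\<forall>a. length a = n \<longrightarrow> trajectory Es a = trajectory Es' a) \<longleftrightarrow>
        (\<forall>a. length a = n \<longrightarrow> update Es a = update Es' a)"
    proof safe
      fix a :: "bool list"
      assume "\<forall>b. length b = length a \<longrightarrow> trajectory Es b = trajectory Es' b"
      then have "trajectory Es a 1 = trajectory Es' a 1" by simp
      then show "update Es a = update Es' a" by (simp add: trajectory_def)
    next
      fix a :: "bool list"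
      assume *: "\<forall>b. length b = length a \<longrightarrow> update Es b = update Es' b" and n: "n = length a"
      show "trajectory Es a = trajectory Es' a"
      proof
        fix t
        show "trajectory Es a t = trajectory Es' a t"
        proof (induction t)
          case (Suc t)
          have "length (trajectory Es' a t) = length a"
            using len n by (intro length_trajectory) simp_all
          with Suc * show ?case by (simp add: trajectory_Suc)
        qed (simp add: trajectory_def)
      qed
    qed
    also have "\<dots> \<longleftrightarrow> (\<forall>x<2 ^ n. T (code_system Es) x 1 = T (code_system Es') x 1)"
    proof safe
      fix x :: nat
      assume *: "\<forall>a. length a = n \<longrightarrow> update Es a = update Es' a" and "x < 2 ^ n"
      then obtain a where "length a = n" "state_mask a = x" using state_mask_surj by blast
      then show "T (code_system Es) x 1 = T (code_system Es') x 1" using * T1[of a] by simp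
    next
      fix a :: "bool list"
      assume *: "\<forall>x<2 ^ length a. T (code_system Es) x 1 = T (code_system Es') x 1" and "n = length a"
      then show "update Es a = update Es' a" using T1[of a] state_mask_less[of a] by simp
    qed
    finally show ?thesis .
  qed
  have "z \<in> ?A \<longleftrightarrow> R z" for z
  proof
    assume "z \<in> ?A"
    then obtain Es Es' n where z: "z = prod_encode (code_system Es, code_system Es')"
      and *: "reentry_system n Es" "reentry_system n Es'"
        "\<forall>a. length a = n \<longrightarrow> trajectory Es a = trajectory Es' a"
      by blast
    moreover have "length Es = n" "length Es' = n" using * by (simp_all add: reentry_system_def)
    ultimately show "R z"
      using eq[of n Es Es'] by (auto simp: R_def S_def code_length_code_system)
  next
    assume "R z"
    then obtain Es Es' where e: "pfst z = code_system Es" "psnd z = code_system Es'"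
      and Es: "reentry_system (length Es) Es" "reentry_system (length Es') Es'"
      unfolding R_def S_def by blast
    with \<open>R z\<close> have len: "length Es' = length Es"
      and "\<forall>x<2 ^ length Es. T (code_system Es) x 1 = T (code_system Es') x 1"
      by (simp_all add: R_def code_length_code_system)
    then have "\<forall>a. length a = length Es \<longrightarrow> trajectory Es a = trajectory Es' a"
      using eq[of "length Es" Es Es'] Es by simp
    moreover have "z = prod_encode (pfst z, psnd z)" by simp
    ultimately show "z \<in> ?A" unfolding e using Es len by auto
  qed
  moreover have "decid R"
    unfolding R_def S_def
    by (intro computable_list_intros T computable_comp[OF decid_code_system])
  ultimately show ?thesis by (simp add: decidable_iff)
qed

theorem proposition8p6:
  "(\<forall>n Es a. reentry_system n Es \<longrightarrow> length a = n \<longrightarrow>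
      (\<exists>p q. ultimately_periodic (trajectory Es a) p q \<and> p + q \<le> 2 ^ n))
   \<and> decidable {prod_encode (code_mso \<phi>, prod_encode (code_system Es, code_state a)) | \<phi> Es a.
        \<exists>n. mso_formula n \<phi> \<and> reentry_system n Es \<and> length a = n \<and> trajectory_sat Es a \<phi>}
   \<and> decidable {prod_encode (prod_encode (code_system Es, code_system Es'),
                             prod_encode (code_state a, code_state a')) | Es Es' a a'.
        \<exists>n. reentry_system n Es \<and> reentry_system n Es' \<and> length a = n \<and> length a' = n \<and>
            trajectory Es a = trajectory Es' a'}
   \<and> decidable {prod_encode (code_system Es, code_system Es') | Es Es'.
        \<exists>n. reentry_system n Es \<and> reentry_system n Es' \<and>
            (\<forall>a. length a = n \<longrightarrow> trajectory Es a = trajectory Es' a)}"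
proof (intro conjI allI impI)
  fix n Es and a :: "bool list"
  assume "reentry_system n Es" "length a = n"
  then obtain p q where "ultimately_periodic (trajectory Es a) p q" "p + q \<le> 2 ^ n"
    by (rule trajectory_ultimately_periodic)
  then show "\<exists>p q. ultimately_periodic (trajectory Es a) p q \<and> p + q \<le> 2 ^ n" by blast
qed (rule decidable_trajectory_sat decidable_trajectory_eq decidable_all_trajectories_eq)+

end
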